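(* Let $S_\varepsilon$ be the one-step operator defined in the context. Then for a Borel set $A\subset\Omega$ it holds that $$S_\varepsilon(A)\in\operatorname*{arg\,min}_{E\in\mathfrak{B}(\Omega)}\ \int_\Omega|\mathbf{1}_E-\mathbf{1}_A|\,\frac{\operatorname{dist}(\cdot,\partial A)}{\varepsilon}\,\mathrm{d}\varrho+\mathrm{Per}_\varepsilon(E),$$ where $\mathfrak{B}(\Omega)$ denotes the Borel subsets of $\Omega$.
   Context: Setting. $\Omega\subset\mathbb{R}^N$ is a bounded domain (non-empty, open, connected), $\varepsilon>0$. $\mu$ is a probability measure on $\Omega\times\{0,1\}$; $\varrho_i:=\mu(\cdot\times\{i\})$ for $i=0,1$, and $\varrho:=\varrho_0+\varrho_1$. The measures $\varrho_0,\varrho_1$ have densities with respect to the Lebesgue measure on $\Omega$, denoted by the same symbols, which are continuously differentiable, $\varrho_i\in C^1(\Omega)$, and there is a constant $c_\varrho>0$ with $c_\varrho<\varrho<c_\varrho^{-1}$ in $\Omega$. $B(x,\varepsilon)$ is the open Euclidean ball. For measurable $u:\Omega\to\mathbb{R}$, $$\mathrm{TV}_\varepsilon(u):=\frac1\varepsilon\Big[\int_\Omega\Big(\operatorname*{ess\,sup}_{B(x,\varepsilon)\cap\Omega}u-u(x)\Big)\mathrm{d}\varrho_0(x)+\int_\Omega\Big(u(x)-\operatorname*{ess\,inf}_{B(x,\varepsilon)\cap\Omega}u\Big)\mathrm{d}\varrho_1(x)\Big],$$ and $\mathrm{Per}_\varepsilon(E):=\mathrm{TV}_\varepsilon(\mathbf{1}_E)$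 for Borel $E\subset\Omega$. Distances. For a Borel set $A\subset\Omega$, $A^1$ denotes the set of points at which $A$ has Lebesgue density $1$ (so that $A^1$ does not change when $A$ is modified by a Lebesgue null set), and $A^c:=\Omega\setminus A$. By (overloaded) definition, $\operatorname{dist}(\cdot,\partial A):=\operatorname{dist}(\cdot,A^1)+\operatorname{dist}(\cdot,\Omega\setminus A^1)$, and $\operatorname{sdist}(\cdot,A):=\operatorname{dist}(\cdot,A^1)-\operatorname{dist}(\cdot,\Omega\setminus A^1)$. One-step operator. For Borel $A\subset\Omega$ let $w^*_\varepsilon$ be the unique minimizer over $u\in L^2(\Omega)$ of $\frac1{2\varepsilon}\int_\Omega|u-\operatorname{sdist}(\cdot,A^c)|^2\,\mathrm{d}\varrho+\mathrm{TV}_\varepsilon(u)$, and set $S_\varepsilon(A):=\{w_\varepsilon^*>0\}$, where the representative of $w^*_\varepsilon$ is chosen such that $\{w^*_\varepsilon>0\}=(\{w_\varepsilon^*>0\})^1$. *)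

theory Defs
  imports "HOL-Probability.Essential_Supremum" "HOL-Probability.Probability_Measure"
begin

definition C1_on :: "'a::euclidean_space set \<Rightarrow> ('a \<Rightarrow> real) \<Rightarrow> bool" where
  "C1_on \<Omega> f \<longleftrightarrow>
     (\<exists>D :: 'a \<Rightarrow> 'a \<Rightarrow>\<^sub>L real.
        (\<forall>x\<in>\<Omega>. (f has_derivative blinfun_apply (D x)) (at x)) \<and> continuous_on \<Omega> D)"

abbreviation leb :: "'a::euclidean_space set \<Rightarrow> 'a measure" where
  "leb \<Omega> \<equiv> restrict_space lborel \<Omega>"

definition borel_subsets :: "'a::euclidean_space set \<Rightarrow> 'a set set" where
  "borel_subsets \<Omega> = {E. E \<in> sets borel \<and> E \<subseteq> \<Omega>}"

definition slice :: "'a::euclidean_space set \<Rightarrow> ('a \<times> nat) measure \<Rightarrow> nat \<Rightarrow> 'a measure" where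
  "slice \<Omega> \<mu> i = measure_of \<Omega> (borel_subsets \<Omega>) (\<lambda>B. emeasure \<mu> (B \<times> {i}))"

definition slice_sum :: "'a::euclidean_space set \<Rightarrow> ('a \<times> nat) measure \<Rightarrow> 'a measure" where
  "slice_sum \<Omega> \<mu> = measure_of \<Omega> (borel_subsets \<Omega>)
     (\<lambda>B. emeasure (slice \<Omega> \<mu> 0) B + emeasure (slice \<Omega> \<mu> 1) B)"

text \<open>Mirrors the library's definition of the essential supremum, which is the
  \<^const>\<open>Limsup\<close> along the almost-everywhere filter.\<close>

definition essinf :: "'a measure \<Rightarrow> ('a \<Rightarrow> ereal) \<Rightarrow> ereal" where
  "essinf M f = (if f \<in> borel_measurable M then Liminf (ae_filter M) f else bot)"

text \<open>The essential supremum and infimum over balls are taken with respect to Lebesgue measure and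
  may be infinite.  Both integrands are nonnegative almost everywhere, so the truncation at \<open>0\<close> by
  \<^const>\<open>e2ennreal\<close> has no effect on the integrals, and the value lies in \<open>[0,\<infinity>]\<close>.\<close>

definition TV :: "'a::euclidean_space set \<Rightarrow> ('a \<times> nat) measure \<Rightarrow> real \<Rightarrow> ('a \<Rightarrow> real) \<Rightarrow> ennreal" where
  "TV \<Omega> \<mu> \<epsilon> u = ennreal (1 / \<epsilon>) *
     ((\<integral>\<^sup>+ x. e2ennreal (esssup (leb (ball x \<epsilon> \<inter> \<Omega>)) (\<lambda>y. ereal (u y)) - ereal (u x)) \<partial>slice \<Omega> \<mu> 0)
    + (\<integral>\<^sup>+ x. e2ennreal (ereal (u x) - essinf (leb (ball x \<epsilon> \<inter> \<Omega>)) (\<lambda>y. ereal (u y))) \<partial>slice \<Omega> \<mu> 1))"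

definition Per :: "'a::euclidean_space set \<Rightarrow> ('a \<times> nat) measure \<Rightarrow> real \<Rightarrow> 'a set \<Rightarrow> ennreal" where
  "Per \<Omega> \<mu> \<epsilon> E = TV \<Omega> \<mu> \<epsilon> (indicat_real E)"

definition density_one :: "'a::euclidean_space set \<Rightarrow> 'a set \<Rightarrow> 'a set" where
  "density_one \<Omega> A = {x\<in>\<Omega>.
     ((\<lambda>r. measure lborel (A \<inter> ball x r) / measure lborel (ball x r)) \<longlongrightarrow> 1) (at_right 0)}"

text \<open>The distance in the bounded domain \<open>\<Omega>\<close> to the set \<open>B\<close>.  All distances in \<open>\<Omega>\<close> lie in
  \<open>[0, diameter \<Omega>]\<close>, and the infimum of the empty set is taken in that interval.  This only matters
  if \<open>A\<close> or its complement is a null set: the customary value \<open>\<infinity>\<close> would then make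
  the signed distance infinite and the minimization problem of the one-step operator
  meaningless, and the library's \<^term>\<open>infdist x {} = 0\<close> would not distinguish
  between \<open>A = {}\<close> and \<open>A = \<Omega>\<close>.\<close>

definition dist_to :: "'a::euclidean_space set \<Rightarrow> 'a \<Rightarrow> 'a set \<Rightarrow> real" where
  "dist_to \<Omega> x B = (if B = {} then diameter \<Omega> else infdist x B)"

definition bdist :: "'a::euclidean_space set \<Rightarrow> 'a set \<Rightarrow> 'a \<Rightarrow> real" where
  "bdist \<Omega> A x = dist_to \<Omega> x (density_one \<Omega> A) + dist_to \<Omega> x (\<Omega> - density_one \<Omega> A)"

definition sdist :: "'a::euclidean_space set \<Rightarrow> 'a set \<Rightarrow> 'a \<Rightarrow> real" where
  "sdist \<Omega> A x = dist_to \<Omega> x (density_one \<Omega> A) - dist_to \<Omega> x (\<Omega> - density_one \<Omega> A)"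

definition L2 :: "'a::euclidean_space set \<Rightarrow> ('a \<Rightarrow> real) set" where
  "L2 \<Omega> = {u \<in> borel_measurable (leb \<Omega>). integrable (leb \<Omega>) (\<lambda>x. (u x)\<^sup>2)}"

definition step_energy ::
  "'a::euclidean_space set \<Rightarrow> ('a \<times> nat) measure \<Rightarrow> real \<Rightarrow> 'a set \<Rightarrow> ('a \<Rightarrow> real) \<Rightarrow> ennreal" where
  "step_energy \<Omega> \<mu> \<epsilon> A u =
     ennreal (1 / (2 * \<epsilon>)) * (\<integral>\<^sup>+ x. ennreal (\<bar>u x - sdist \<Omega> (\<Omega> - A) x\<bar>\<^sup>2) \<partial>slice_sum \<Omega> \<mu>)
     + TV \<Omega> \<mu> \<epsilon> u"

text \<open>The minimizer is unique as an element of \<open>L\<^sup>2\<close>, that is, up to null sets; the choice operator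
  selects a representative whose positivity set consists of its points of density one.
  Any two such representatives have the same positivity set.\<close>

definition w_star ::
  "'a::euclidean_space set \<Rightarrow> ('a \<times> nat) measure \<Rightarrow> real \<Rightarrow> 'a set \<Rightarrow> 'a \<Rightarrow> real" where
  "w_star \<Omega> \<mu> \<epsilon> A = (SOME w.
     is_arg_min (step_energy \<Omega> \<mu> \<epsilon> A) (\<lambda>u. u \<in> L2 \<Omega>) w \<and>
     {x\<in>\<Omega>. w x > 0} = density_one \<Omega> {x\<in>\<Omega>. w x > 0})"

definition one_step ::
  "'a::euclidean_space set \<Rightarrow> ('a \<times> nat) measure \<Rightarrow> real \<Rightarrow> 'a set \<Rightarrow> 'a set" where
  "one_step \<Omega> \<mu> \<epsilon> A = {x\<in>\<Omega>. w_star \<Omega> \<mu> \<epsilon> A x > 0}"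

end

theory Submission
  imports Defs
begin

text \<open>
  Let \<open>w\<close> minimize the energy of the one-step operator and put \<open>p = (g - w) / \<epsilon>\<close>,
  where \<open>g\<close> is the signed distance to the complement of \<open>A\<close>. Such a \<open>w\<close> exists because the
  parallelogram identity makes minimizing sequences Cauchy and the total variation is
  lower semicontinuous by Fatou's lemma. Since the total variation is subadditive and positively
  homogeneous, the first variation in direction \<open>1\<^sub>E\<close> gives \<open>Per E \<ge> \<integral>\<^sub>E p\<close> for every \<open>E\<close>.
  For a truncation \<open>h = min (max w 0) \<delta>\<close> the functions \<open>w - s h\<close> and \<open>s h\<close> are nondecreasing
  functions of \<open>w\<close>, so their total variations add up to at most that of \<open>w\<close>, and the
  variation in direction \<open>- h\<close> gives \<open>TV h \<le> \<integral> p h\<close>.  As \<open>h / \<delta>\<close> tends to the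
  indicator of \<open>W = {w > 0}\<close> for \<open>\<delta> \<rightarrow> 0\<close>, lower semicontinuity yields \<open>Per W \<le> \<integral>\<^sub>W p\<close>,
  without recourse to a coarea formula. Up to a constant the geometric functional is
  \<open>Per E - \<integral>\<^sub>E g / \<epsilon>\<close>, so it is at least \<open>- \<integral>\<^sub>E w / \<epsilon>\<close>, with equality for \<open>W\<close>,
  and \<open>\<integral>\<^sub>E w\<close> is largest for \<open>E = W\<close>.
\<close>

section \<open>Points of density one\<close>

text \<open>The strict inequality makes this set open. Density one fails at a point exactly if, for
  some fixed \<open>q < 1\<close>, the point lies in these sets for arbitrarily small
  \<open>d\<close>, so countably many of them describe \<open>density_one\<close>.\<close>

definition thin_points :: "'a::euclidean_space set \<Rightarrow> real \<Rightarrow> real \<Rightarrow> 'a set" where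
  "thin_points A q d =
     {x. \<exists>r. 0 < r \<and> r < d \<and> measure lborel (A \<inter> ball x r) < q * measure lborel (ball x r)}"

lemma emeasure_lborel_bounded_eq_measure:
  fixes A :: "'a::euclidean_space set"
  assumes "bounded A"
  shows "emeasure lborel A = ennreal (measure lborel A)"
  using emeasure_bounded_finite[OF assms] by (simp add: emeasure_eq_ennreal_measure)

lemma emeasure_lborel_bounded_neq_top:
  fixes A :: "'a::euclidean_space set"
  shows "bounded A \<Longrightarrow> emeasure lborel A \<noteq> \<infinity>"
  using emeasure_bounded_finite[of A] by auto

lemma measure_lborel_ball_pos:
  "0 < r \<Longrightarrow> 0 < measure lborel (ball (x::'a::euclidean_space) r)"
  by (rule content_ball_pos)

text \<open>Moving the centre from \<open>x\<close> to a nearby \<open>y\<close> with the radius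
  kept adds to \<open>A \<inter> ball x r\<close> at most a thin shell around
  \<open>ball x r\<close>. The volume of the shell tends to zero, so the strict inequality
  survives.\<close>

lemma open_thin_points:
  fixes A :: "'a::euclidean_space set"
  assumes A: "A \<in> sets borel"
  shows "open (thin_points A q d)"
proof -
  have "\<exists>e>0. \<forall>y. dist y x < e \<longrightarrow> y \<in> thin_points A q d" if "x \<in> thin_points A q d" for x
  proof -
    from that obtain r where r: "0 < r" "r < d"
      and lt: "measure lborel (A \<inter> ball x r) < q * measure lborel (ball x r)"
      by (auto simp: thin_points_def)
    let ?V = "\<lambda>s. measure lborel (ball x s)"
    let ?c = "measure lborel (ball (0::'a) 1)"
    have "((\<lambda>s. s ^ DIM('a) * ?c) \<longlongrightarrow> r ^ DIM('a) * ?c) (at_right r)"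
      by (intro tendsto_intros)
    then have "((\<lambda>s. s ^ DIM('a) * ?c - r ^ DIM('a) * ?c) \<longlongrightarrow> 0) (at_right r)"
      by (simp add: LIM_zero)
    then have "\<forall>\<^sub>F s in at_right r. s ^ DIM('a) * ?c - r ^ DIM('a) * ?c
        < q * ?V r - measure lborel (A \<inter> ball x r)"
      using lt by (intro order_tendstoD) auto
    \<comment> \<open>For \<open>s < s0\<close> the shell \<open>ball x s - ball x r\<close> has
      less volume than the slack in the strict inequality, whence the radius \<open>s0 - r\<close>
      of openness.\<close>
    then obtain s0 where "s0 > r" and s0: "\<And>s. r < s \<Longrightarrow> s < s0 \<Longrightarrow>
        s ^ DIM('a) * ?c - r ^ DIM('a) * ?c < q * ?V r - measure lborel (A \<inter> ball x r)"
      by (auto simp: eventually_at_right_field)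
    show ?thesis
    proof (intro exI[of _ "s0 - r"] conjI allI impI)
      fix y assume y: "dist y x < s0 - r"
      show "y \<in> thin_points A q d"
      \<comment> \<open>The bound on the shell is only available for \<open>s > r\<close>, so the
        centre itself is treated apart.\<close>
      proof (cases "y = x")
        case False
        define s where "s = r + dist y x"
        have s: "r < s" "s < s0" using False y by (auto simp: s_def)
        have sub: "A \<inter> ball y r \<subseteq> (A \<inter> ball x r) \<union> (ball x s - ball x r)"
        proof
          fix z assume z: "z \<in> A \<inter> ball y r"
          then have "dist x z < s"
            using dist_triangle[of x z y] by (simp add: s_def dist_commute)
          with z show "z \<in> (A \<inter> ball x r) \<union> (ball x s - ball x r)" by auto
        qed
        have "measure lborel (A \<inter> ball y r) \<le> measure lborel ((A \<inter> ball x r) \<union> (ball x s - ball x r))"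
          using A by (intro measure_mono_fmeasurable[OF sub] fmeasurable.Un)
            (auto intro!: fmeasurableI emeasure_bounded_finite simp: bounded_Int less_top[symmetric] bounded_diff)
        also have "\<dots> \<le> measure lborel (A \<inter> ball x r) + measure lborel (ball x s - ball x r)"
          using A by (intro measure_Un_le) auto
        also have "measure lborel (ball x s - ball x r) = ?V s - ?V r"
          using s r emeasure_lborel_bounded_neq_top[OF bounded_ball, of x s]
          by (intro measure_Diff) (auto simp: subset_ball)
        also have "\<dots> = s ^ DIM('a) * ?c - r ^ DIM('a) * ?c"
          using s r content_ball_conv_unit_ball[of s x] content_ball_conv_unit_ball[of r x] by simp
        also have "measure lborel (A \<inter> ball x r) + \<dots> < q * ?V r"
          using s0[OF s] by simp
        also have "?V r = measure lborel (ball y r)"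
          using r content_ball_conv_unit_ball[of r y] content_ball_conv_unit_ball[of r x] by simp
        finally show ?thesis using r by (auto simp: thin_points_def)
      qed (use that in simp)
    qed (use \<open>s0 > r\<close> in simp)
  qed
  then show ?thesis by (auto simp: open_dist)
qed

text \<open>The density quotient never exceeds one, so convergence to one consists of lower bounds
  only. The thresholds \<open>1 - 1 / (k + 1)\<close> and radii \<open>1 / (m + 1)\<close> reduce
  these to countably many conditions, which yields Borel measurability.\<close>

lemma density_one_eq_thin_points:
  fixes A :: "'a::euclidean_space set"
  assumes A: "A \<in> sets borel"
  shows "density_one \<Omega> A =
    \<Omega> - (\<Union>k::nat. \<Inter>m::nat. thin_points A (1 - 1 / (real k + 1)) (1 / (real m + 1)))"
proof -
  let ?V = "\<lambda>x r. measure lborel (ball (x::'a) r)"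
  let ?f = "\<lambda>x r. measure lborel (A \<inter> ball x r) / ?V x r"
  have le1: "?f x r \<le> 1" for x r
  proof (cases "r > 0")
    case True
    have "measure lborel (A \<inter> ball x r) \<le> ?V x r"
      using A by (intro measure_mono_fmeasurable)
        (auto intro!: fmeasurableI emeasure_bounded_finite simp: less_top[symmetric])
    then show ?thesis by (auto simp: divide_le_eq_1)
  next
    case False
    then have e: "ball x r = {}" by simp
    show ?thesis unfolding e by simp
  qed
  have *: "(?f x \<longlongrightarrow> 1) (at_right 0) \<longleftrightarrow>
      (\<forall>k::nat. \<exists>m::nat. x \<notin> thin_points A (1 - 1 / (real k + 1)) (1 / (real m + 1)))" (is "?L \<longleftrightarrow> ?R") for x
  proof
    assume L: ?L
    show ?R
    proof
      fix k :: nat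
      have "\<forall>\<^sub>F r in at_right 0. 1 - 1 / (real k + 1) < ?f x r"
        using L by (rule order_tendstoD) simp
      then obtain b where b: "b > 0" "\<And>r. 0 < r \<Longrightarrow> r < b \<Longrightarrow> 1 - 1 / (real k + 1) < ?f x r"
        by (auto simp: eventually_at_right_field)
      obtain m where m: "1 / (real m + 1) < b"
        using reals_Archimedean[OF b(1)] by (auto simp: inverse_eq_divide add.commute)
      have "x \<notin> thin_points A (1 - 1 / (real k + 1)) (1 / (real m + 1))"
      proof
        assume "x \<in> thin_points A (1 - 1 / (real k + 1)) (1 / (real m + 1))"
        then obtain r where r: "0 < r" "r < 1 / (real m + 1)"
          "measure lborel (A \<inter> ball x r) < (1 - 1 / (real k + 1)) * ?V x r"
          by (auto simp: thin_points_def)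
        with m b(2)[of r] measure_lborel_ball_pos[OF r(1), of x] show False
          by (simp add: pos_less_divide_eq)
      qed
      then show "\<exists>m::nat. x \<notin> thin_points A (1 - 1 / (real k + 1)) (1 / (real m + 1))" ..
    qed
  next
    assume R: ?R
    show ?L
    proof (rule order_tendstoI)
      fix a :: real assume "a < 1"
      then obtain k :: nat where k: "1 / (real k + 1) < 1 - a"
        using reals_Archimedean[of "1 - a"] by (auto simp: inverse_eq_divide add.commute)
      obtain m :: nat where m: "x \<notin> thin_points A (1 - 1 / (real k + 1)) (1 / (real m + 1))"
        using R by blast
      have "a < ?f x r" if "0 < r" "r < 1 / (real m + 1)" for r
      proof -
        have "(1 - 1 / (real k + 1)) * ?V x r \<le> measure lborel (A \<inter> ball x r)"
          using m that unfolding thin_points_def by (metis (mono_tags, lifting) mem_Collect_eq not_less)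
        then have "1 - 1 / (real k + 1) \<le> ?f x r"
          using measure_lborel_ball_pos[OF that(1), of x] by (simp add: pos_le_divide_eq)
        with k show ?thesis by linarith
      qed
      then show "\<forall>\<^sub>F r in at_right 0. a < ?f x r"
        by (auto simp: eventually_at_right_field intro!: exI[of _ "1 / (real m + 1)"])
    next
      fix a :: real assume "1 < a"
      then show "\<forall>\<^sub>F r in at_right 0. ?f x r < a"
        using le1 by (intro always_eventually) (auto intro: le_less_trans)
    qed
  qed
  show ?thesis
    unfolding density_one_def by (auto simp: *)
qed

lemma density_one_borel:
  assumes "A \<in> sets borel" "\<Omega> \<in> sets borel"
  shows "density_one \<Omega> A \<in> sets borel"
  unfolding density_one_eq_thin_points[OF assms(1)]
  using assms open_thin_points[OF assms(1)] by (intro sets.Diff sets.countable_UN sets.countable_INT'') auto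

text \<open>The core of Lebesgue's density theorem. Vitali's theorem covers almost all of the set by
  disjoint balls inside a slightly larger open set, and \<open>A\<close> fills at most the fraction
  \<open>q\<close> of each ball. So the measure is at most \<open>q\<close> times itself plus an
  arbitrarily small error, and \<open>q < 1\<close> forces it to vanish.\<close>

lemma thin_points_null:
  fixes A :: "'a::euclidean_space set"
  assumes A: "A \<in> sets borel" "bounded A" and q: "0 \<le> q" "q < 1"
  shows "A \<inter> (\<Inter>m::nat. thin_points A q (1 / (real m + 1))) \<in> null_sets lborel" (is "?N \<in> _")
proof -
  have N: "?N \<in> sets borel"
    using A open_thin_points[OF A(1)] by (intro sets.Int sets.countable_INT'') auto
  have bN: "bounded ?N" using A by (auto simp: bounded_Int)
  have le: "measure lborel ?N \<le> q * (measure lborel ?N + e)" if e: "e > 0" for e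
  proof -
    obtain U where U: "open U" "?N \<subseteq> U" "emeasure lborel (U - ?N) < ennreal e"
      using outer_regular_lborel[OF N e] by blast
    \<comment> \<open>Keeping the balls inside \<open>U\<close> bounds the total volume of disjoint
      ones by that of \<open>U\<close>, hence by the measure of \<open>?N\<close> plus
      \<open>e\<close>.\<close>
    define K where "K = {(x, r). 0 < r \<and> ball x r \<subseteq> U \<and>
      measure lborel (A \<inter> ball x r) < q * measure lborel (ball x r)}"
    have cov: "\<exists>i. i \<in> K \<and> x \<in> ball (fst i) (snd i) \<and> snd i < d" if x: "x \<in> ?N" "0 < d" for x d
    proof -
      obtain b where b: "b > 0" "ball x b \<subseteq> U"
        using U x by (meson open_contains_ball subsetD)
      obtain m where m: "1 / (real m + 1) < min b d"
        using reals_Archimedean[of "min b d"] b x by (auto simp: inverse_eq_divide add.commute)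
      from x have "x \<in> thin_points A q (1 / (real m + 1))" by (auto simp: add.commute)
      then obtain r where r: "0 < r" "r < 1 / (real m + 1)"
        "measure lborel (A \<inter> ball x r) < q * measure lborel (ball x r)"
        by (auto simp: thin_points_def)
      have "ball x r \<subseteq> U" using r m b by (auto intro: order_trans[OF subset_ball])
      with r m show ?thesis by (intro exI[of _ "(x, r)"]) (auto simp: K_def)
    qed
    obtain C where C: "countable C" "C \<subseteq> K"
      "pairwise (\<lambda>i j. disjnt (ball (fst i) (snd i)) (ball (fst j) (snd j))) C"
      "negligible (?N - (\<Union>i\<in>C. ball (fst i) (snd i)))"
      by (rule Vitali_covering_theorem_balls[of ?N K fst snd, OF cov]) auto
    let ?B = "\<lambda>i. ball (fst i) (snd i) :: 'a set"
    let ?W = "\<Union>i\<in>C. ?B i"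
    have disj: "disjoint_family_on ?B C" "disjoint_family_on (\<lambda>i. A \<inter> ?B i) C"
      using C(3) unfolding disjoint_family_on_def pairwise_def disjnt_def by blast+
    have W: "?W \<in> sets borel" by (intro borel_open open_UN) auto
    have WU: "?W \<subseteq> U" using C(2) unfolding K_def by fastforce
    have "?N - ?W \<in> null_sets lborel"
      using C(4) N W by (auto simp: negligible_iff_null_sets null_sets_completion_iff)
    then have "emeasure lborel ?N = emeasure lborel (?N - (?N - ?W))"
      using N by (subst emeasure_Diff_null_set) auto
    also have "\<dots> \<le> emeasure lborel (\<Union>i\<in>C. A \<inter> ?B i)"
      using A W by (intro emeasure_mono) auto
    also have "\<dots> = (\<integral>\<^sup>+i. emeasure lborel (A \<inter> ?B i) \<partial>count_space C)"
      using A C disj by (intro emeasure_UN_countable) auto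
    also have "\<dots> \<le> (\<integral>\<^sup>+i. ennreal q * emeasure lborel (?B i) \<partial>count_space C)"
    proof (rule nn_integral_mono)
      fix i assume "i \<in> space (count_space C)"
      then have "i \<in> K" using C by auto
      then have "measure lborel (A \<inter> ?B i) \<le> q * measure lborel (?B i)"
        by (auto simp: K_def)
      then have "ennreal (measure lborel (A \<inter> ?B i)) \<le> ennreal q * ennreal (measure lborel (?B i))"
        using q by (simp add: ennreal_mult[symmetric] ennreal_leI)
      then show "emeasure lborel (A \<inter> ?B i) \<le> ennreal q * emeasure lborel (?B i)"
        by (simp add: emeasure_lborel_bounded_eq_measure bounded_Int)
    qed
    also have "\<dots> = ennreal q * (\<integral>\<^sup>+i. emeasure lborel (?B i) \<partial>count_space C)"
      by (intro nn_integral_cmult) auto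
    also have "(\<integral>\<^sup>+i. emeasure lborel (?B i) \<partial>count_space C) = emeasure lborel ?W"
      using C disj by (intro emeasure_UN_countable[symmetric]) auto
    also have "emeasure lborel ?W \<le> emeasure lborel (?N \<union> (U - ?N))"
      using N U WU by (intro emeasure_mono) auto
    also have "\<dots> \<le> emeasure lborel ?N + emeasure lborel (U - ?N)"
      using N U by (intro emeasure_subadditive) auto
    also have "\<dots> \<le> emeasure lborel ?N + ennreal e"
      using U by (intro add_left_mono) auto
    finally show ?thesis
      using bN q e
      by (simp add: emeasure_lborel_bounded_eq_measure mult_left_mono ennreal_plus[symmetric]
          ennreal_mult[symmetric] del: ennreal_plus)
  qed
  have "measure lborel ?N \<le> q * measure lborel ?N"
  proof (rule field_le_epsilon)
    fix e :: real assume e: "e > 0"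
    have "q * e \<le> e" using q e by (simp add: mult_left_le_one_le)
    then show "measure lborel ?N \<le> q * measure lborel ?N + e"
      using le[OF e] by (simp add: algebra_simps)
  qed
  then have "(1 - q) * measure lborel ?N \<le> 0" by (simp add: algebra_simps)
  then have "measure lborel ?N \<le> 0" using q by (simp add: mult_le_0_iff)
  then have "measure lborel ?N = 0" using measure_nonneg[of lborel ?N] by linarith
  then show ?thesis
    using N bN by (intro null_setsI) (auto simp: emeasure_lborel_bounded_eq_measure)
qed

lemma diff_density_one_null:
  fixes A :: "'a::euclidean_space set"
  assumes A: "A \<in> sets borel" "bounded A" "A \<subseteq> \<Omega>"
  shows "A - density_one \<Omega> A \<in> null_sets lborel"
proof -
  have "A - density_one \<Omega> A =
      (\<Union>k::nat. A \<inter> (\<Inter>m::nat. thin_points A (1 - 1 / (real k + 1)) (1 / (real m + 1))))"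
    using A unfolding density_one_eq_thin_points[OF A(1)] by auto
  also have "\<dots> \<in> null_sets lborel"
    using A by (intro null_sets_UN' thin_points_null) auto
  finally show ?thesis .
qed

lemma density_one_cong:
  fixes A B :: "'a::euclidean_space set"
  assumes "A \<in> sets borel" "B \<in> sets borel" and AE: "AE x in lborel. x \<in> A \<longleftrightarrow> x \<in> B"
  shows "density_one \<Omega> A = density_one \<Omega> B"
proof -
  have "measure lborel (A \<inter> ball x r) = measure lborel (B \<inter> ball x r)" for x r
    using assms by (intro measure_eq_AE) (auto elim: eventually_mono)
  then show ?thesis by (simp add: density_one_def)
qed

text \<open>Small balls about a point of the open set \<open>\<Omega>\<close> lie in
  \<open>\<Omega>\<close>, so the density quotients of \<open>A\<close> and of
  \<open>\<Omega> - A\<close> add up to one there and cannot both tend to one.\<close>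

lemma density_one_Int_compl:
  fixes A :: "'a::euclidean_space set"
  assumes A: "A \<in> sets borel" and \<Omega>: "open \<Omega>"
  shows "density_one \<Omega> A \<inter> density_one \<Omega> (\<Omega> - A) = {}"
proof (rule ccontr)
  assume "\<not> ?thesis"
  then obtain x where x: "x \<in> \<Omega>"
    and lim: "((\<lambda>r. measure lborel (A \<inter> ball x r) / measure lborel (ball x r)) \<longlongrightarrow> 1) (at_right 0)"
      "((\<lambda>r. measure lborel ((\<Omega> - A) \<inter> ball x r) / measure lborel (ball x r)) \<longlongrightarrow> 1) (at_right 0)"
    by (auto simp: density_one_def)
  obtain b where b: "b > 0" "ball x b \<subseteq> \<Omega>"
    using \<Omega> x by (meson open_contains_ball)
  have "\<forall>\<^sub>F r in at_right 0. measure lborel (A \<inter> ball x r) / measure lborel (ball x r)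
      + measure lborel ((\<Omega> - A) \<inter> ball x r) / measure lborel (ball x r) = 1"
  proof -
    have "measure lborel (A \<inter> ball x r) / measure lborel (ball x r)
      + measure lborel ((\<Omega> - A) \<inter> ball x r) / measure lborel (ball x r) = 1" if r: "0 < r" "r < b" for r
    proof -
      have "measure lborel ((A \<inter> ball x r) \<union> ((\<Omega> - A) \<inter> ball x r)) =
          measure lborel (A \<inter> ball x r) + measure lborel ((\<Omega> - A) \<inter> ball x r)"
        using A \<Omega> by (intro measure_Union emeasure_lborel_bounded_neq_top) (auto simp: bounded_Int)
      also have "(A \<inter> ball x r) \<union> ((\<Omega> - A) \<inter> ball x r) = ball x r"
        using b r by (auto intro!: subsetD[OF b(2)])
      finally show ?thesis
        using measure_lborel_ball_pos[OF r(1), of x] by (simp add: add_divide_distrib[symmetric])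
    qed
    then show ?thesis using b by (auto simp: eventually_at_right_field)
  qed
  moreover have "((\<lambda>r. measure lborel (A \<inter> ball x r) / measure lborel (ball x r)
      + measure lborel ((\<Omega> - A) \<inter> ball x r) / measure lborel (ball x r)) \<longlongrightarrow> 1 + 1) (at_right 0)"
    by (intro tendsto_add lim)
  ultimately have "((\<lambda>r. 1::real) \<longlongrightarrow> 1 + 1) (at_right (0::real))"
    by (rule Lim_transform_eventually[rotated])
  then show False
    by (simp add: tendsto_const_iff)
qed

text \<open>Lebesgue's density theorem. \<open>diff_density_one_null\<close> is applied to
  \<open>A\<close> and to \<open>\<Omega> - A\<close>, and disjointness of the two density-one sets
  turns the second application into the reverse inclusion up to a null set.\<close>

lemma density_one_AE_eq:
  fixes A :: "'a::euclidean_space set"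
  assumes A: "A \<in> sets borel" "A \<subseteq> \<Omega>" and \<Omega>: "open \<Omega>" "bounded \<Omega>"
  shows "AE x in lborel. x \<in> A \<longleftrightarrow> x \<in> density_one \<Omega> A"
proof -
  have "A - density_one \<Omega> A \<in> null_sets lborel"
    using A \<Omega> by (intro diff_density_one_null) (auto intro: bounded_subset)
  moreover have "(\<Omega> - A) - density_one \<Omega> (\<Omega> - A) \<in> null_sets lborel"
    using A \<Omega> by (intro diff_density_one_null) (auto intro: bounded_subset)
  ultimately show ?thesis
    using density_one_Int_compl[OF A(1) \<Omega>(1)]
    by (auto simp: density_one_def[of \<Omega>] dest!: AE_not_in elim!: eventually_elim2)
qed

text \<open>The density-one set depends on \<open>A\<close> only modulo null sets and represents the
  same class. It can therefore serve as the positivity set of a representative of the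
  minimizer.\<close>

lemma density_one_idem:
  fixes A :: "'a::euclidean_space set"
  assumes A: "A \<in> sets borel" "A \<subseteq> \<Omega>" and \<Omega>: "open \<Omega>" "bounded \<Omega>"
  shows "density_one \<Omega> (density_one \<Omega> A) = density_one \<Omega> A"
  using density_one_AE_eq[OF A \<Omega>] A \<Omega>
  by (intro density_one_cong density_one_borel) (auto elim: eventually_mono)

section \<open>Distances and complements\<close>

lemma dist_to_nonneg: "bounded \<Omega> \<Longrightarrow> 0 \<le> dist_to \<Omega> x B"
  by (auto simp: dist_to_def infdist_nonneg diameter_ge_0)

lemma dist_to_le_diameter:
  assumes "bounded \<Omega>" "B \<subseteq> \<Omega>" "x \<in> \<Omega>"
  shows "dist_to \<Omega> x B \<le> diameter \<Omega>"
proof (cases "B = {}")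
  case False
  then obtain b where b: "b \<in> B" by blast
  then have "infdist x B \<le> dist x b" by (rule infdist_le)
  also have "\<dots> \<le> diameter \<Omega>"
    using assms b by (intro diameter_bounded_bound) auto
  finally show ?thesis using False by (simp add: dist_to_def)
qed (simp add: dist_to_def)

lemma dist_to_measurable [measurable]: "(\<lambda>x. dist_to \<Omega> x B) \<in> borel_measurable borel"
  by (cases "B = {}") (auto simp: dist_to_def intro!: borel_measurable_continuous_onI continuous_intros)

text \<open>If a ball about \<open>q\<close> contained no density-one point of
  \<open>\<Omega> - A\<close>, then \<open>A\<close> would fill this ball up to a null set, and
  \<open>q\<close> would have density one for \<open>A\<close>.\<close>

lemma compl_density_one_subset_closure:
  fixes A :: "'a::euclidean_space set"
  assumes A: "A \<in> sets borel" and \<Omega>: "open \<Omega>" "bounded \<Omega>"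
  shows "\<Omega> - density_one \<Omega> A \<subseteq> closure (density_one \<Omega> (\<Omega> - A))"
proof
  fix q assume q: "q \<in> \<Omega> - density_one \<Omega> A"
  show "q \<in> closure (density_one \<Omega> (\<Omega> - A))"
  proof (rule ccontr)
    assume "\<not> ?thesis"
    then have "open (\<Omega> - closure (density_one \<Omega> (\<Omega> - A)))" "q \<in> \<Omega> - closure (density_one \<Omega> (\<Omega> - A))"
      using q \<Omega> by auto
    then obtain e where e: "e > 0" "ball q e \<subseteq> \<Omega> - closure (density_one \<Omega> (\<Omega> - A))"
      by (meson open_contains_ball)
    have "AE x in lborel. x \<in> \<Omega> - A \<longleftrightarrow> x \<in> density_one \<Omega> (\<Omega> - A)"
      using A \<Omega> by (intro density_one_AE_eq) auto
    then have AE: "AE x in lborel. x \<in> ball q e \<longrightarrow> x \<in> A"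
    proof (rule eventually_mono, intro impI)
      fix x assume "x \<in> \<Omega> - A \<longleftrightarrow> x \<in> density_one \<Omega> (\<Omega> - A)" "x \<in> ball q e"
      then show "x \<in> A" using e(2) closure_subset[of "density_one \<Omega> (\<Omega> - A)"] by blast
    qed
    have "measure lborel (A \<inter> ball q r) / measure lborel (ball q r) = 1" if r: "0 < r" "r < e" for r
    proof -
      have "measure lborel (A \<inter> ball q r) = measure lborel (ball q r)"
        using AE A r by (intro measure_eq_AE) (auto elim!: eventually_mono)
      then show ?thesis using measure_lborel_ball_pos[OF r(1), of q] by simp
    qed
    then have "\<forall>\<^sub>F r in at_right 0. 1 = measure lborel (A \<inter> ball q r) / measure lborel (ball q r)"
      using e(1) by (auto simp: eventually_at_right_field)
    then have "((\<lambda>r. measure lborel (A \<inter> ball q r) / measure lborel (ball q r)) \<longlongrightarrow> 1) (at_right 0)"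
      by (rule Lim_transform_eventually[OF tendsto_const])
    then show False using q by (simp add: density_one_def)
  qed
qed

text \<open>\<open>?Q\<close> lies between \<open>?P\<close> and the closure of \<open>?P\<close>,
  and distances do not distinguish a set from its closure.\<close>

lemma dist_to_density_one_compl:
  fixes A :: "'a::euclidean_space set"
  assumes A: "A \<in> sets borel" and \<Omega>: "open \<Omega>" "bounded \<Omega>"
  shows "dist_to \<Omega> x (density_one \<Omega> (\<Omega> - A)) = dist_to \<Omega> x (\<Omega> - density_one \<Omega> A)" (is "dist_to _ _ ?P = dist_to _ _ ?Q")
proof (cases "?P = {}")
  \<comment> \<open>The closure of the empty set is empty, so \<open>?Q\<close> is empty as well and
    both sides take the default value \<open>diameter \<Omega>\<close>.\<close>
  case True
  then have "?P = ?Q" using compl_density_one_subset_closure[OF assms] by auto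
  then show ?thesis by (rule arg_cong)
next
  case False
  have sub: "?P \<subseteq> ?Q"
    using density_one_Int_compl[OF A \<Omega>(1)] by (auto simp: density_one_def)
  then have Q: "?Q \<noteq> {}" using False by blast
  have "infdist x ?Q \<le> infdist x ?P" using sub False by (intro infdist_mono)
  moreover have "infdist x (closure ?P) \<le> infdist x ?Q"
    using compl_density_one_subset_closure[OF assms] Q by (intro infdist_mono)
  ultimately show ?thesis using False Q by (simp add: dist_to_def infdist_eq_setdist)
qed

text \<open>At each point of \<open>\<Omega>\<close> one of the two distances vanishes, so their sum
  and their difference agree up to a sign that tells on which side of the boundary the point
  lies.\<close>

lemma sdist_compl:
  fixes A :: "'a::euclidean_space set"
  assumes A: "A \<in> sets borel" "A \<subseteq> \<Omega>" and \<Omega>: "open \<Omega>" "bounded \<Omega>" and x: "x \<in> \<Omega>"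
  shows "sdist \<Omega> (\<Omega> - A) x = (if x \<in> density_one \<Omega> A then bdist \<Omega> A x else - bdist \<Omega> A x)"
proof -
  have AA: "\<Omega> - (\<Omega> - A) = A" using A by auto
  have "sdist \<Omega> (\<Omega> - A) x = dist_to \<Omega> x (\<Omega> - density_one \<Omega> A) - dist_to \<Omega> x (density_one \<Omega> A)"
    using dist_to_density_one_compl[of A \<Omega> x] dist_to_density_one_compl[of "\<Omega> - A" \<Omega> x] A \<Omega>
    by (simp add: sdist_def AA)
  moreover have "dist_to \<Omega> x (density_one \<Omega> A) = 0" if "x \<in> density_one \<Omega> A"
    using that by (auto simp: dist_to_def)
  moreover have "dist_to \<Omega> x (\<Omega> - density_one \<Omega> A) = 0" if "x \<notin> density_one \<Omega> A"
  proof -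
    have "x \<in> \<Omega> - density_one \<Omega> A" using that x by blast
    then show ?thesis unfolding dist_to_def by (metis empty_iff infdist_zero)
  qed
  ultimately show ?thesis by (simp add: bdist_def)
qed

section \<open>The nonlocal total variation\<close>

lemma liminf_superadditive_ennreal:
  fixes f g :: "nat \<Rightarrow> ennreal"
  shows "liminf f + liminf g \<le> liminf (\<lambda>n. f n + g n)"
proof -
  have "liminf f + liminf g = (SUP n. (INF m\<in>{n..}. f m) + (INF m\<in>{n..}. g m))"
    unfolding liminf_SUP_INF
    by (subst ennreal_SUP_add) (auto intro!: incseq_SucI INF_superset_mono)
  also have "\<dots> \<le> (SUP n. INF m\<in>{n..}. f m + g m)"
    by (intro SUP_mono' INF_greatest add_mono INF_lower) auto
  finally show ?thesis unfolding liminf_SUP_INF .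
qed

lemma liminf_cmult_ennreal:
  fixes f :: "nat \<Rightarrow> ennreal"
  assumes "0 \<le> r"
  shows "ennreal r * liminf f \<le> liminf (\<lambda>n. ennreal r * f n)"
  using assms unfolding liminf_SUP_INF SUP_mult_left_ennreal
  by (intro SUP_mono' INF_greatest mult_left_mono INF_lower) auto

lemma e2ennreal_add_le: "e2ennreal (a + b) \<le> e2ennreal a + e2ennreal b"
proof (cases a; cases b)
  fix r s assume "a = ereal r" "b = ereal s"
  then show ?thesis
    by (cases "r \<ge> 0"; cases "s \<ge> 0")
      (auto simp: ennreal_neg ennreal_plus[symmetric] intro!: ennreal_leI simp del: ennreal_plus)
qed (auto simp: e2ennreal_neg)

lemma e2ennreal_add:
  assumes "0 \<le> a" "0 \<le> b"
  shows "e2ennreal (a + b) = e2ennreal a + e2ennreal b"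
  using assms by (cases a; cases b) auto

lemma e2ennreal_cmult:
  assumes "0 < r"
  shows "e2ennreal (ereal r * a) = ennreal r * e2ennreal a"
proof (cases a)
  case (real x)
  then show ?thesis using assms
    by (cases "x \<ge> 0") (auto simp: ennreal_mult ennreal_neg mult_nonneg_nonpos)
qed (use assms in \<open>auto simp: e2ennreal_neg ennreal_mult_top\<close>)

lemma essinf_eq_esssup_uminus:
  assumes "f \<in> borel_measurable M"
  shows "essinf M f = - esssup M (\<lambda>x. - f x)"
  using assms ereal_Liminf_uminus[of "ae_filter M" "\<lambda>x. - f x"]
  by (simp add: essinf_def esssup_def)

text \<open>One-sided local oscillation: \<open>TV\<close> integrates it for \<open>u\<close> over
  the first slice and for \<open>- u\<close> over the second.\<close>

definition osc :: "'a::euclidean_space set \<Rightarrow> real \<Rightarrow> ('a \<Rightarrow> real) \<Rightarrow> 'a \<Rightarrow> ennreal" where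
  "osc \<Omega> \<epsilon> u x = e2ennreal (esssup (leb (ball x \<epsilon> \<inter> \<Omega>)) (\<lambda>y. ereal (u y)) - ereal (u x))"

section \<open>The setting, its slices and the weighted measure\<close>

locale nonlocal_perimeter =
  fixes \<Omega> :: "'a::euclidean_space set" and \<mu> :: "('a \<times> nat) measure"
    and \<rho> :: "nat \<Rightarrow> 'a \<Rightarrow> real" and \<epsilon> c :: real
  assumes open_\<Omega>: "open \<Omega>" and bounded_\<Omega>: "bounded \<Omega>"
    and eps_pos: "\<epsilon> > 0" and c_pos: "c > 0"
    and rho_nonneg: "\<And>i x. i \<in> {0, 1} \<Longrightarrow> x \<in> \<Omega> \<Longrightarrow> \<rho> i x \<ge> 0"
    and rho_measurable: "\<And>i. i \<in> {0, 1} \<Longrightarrow> \<rho> i \<in> borel_measurable (leb \<Omega>)"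
    and slice_eq: "\<And>i. i \<in> {0, 1} \<Longrightarrow> slice \<Omega> \<mu> i = density (leb \<Omega>) (\<lambda>x. ennreal (\<rho> i x))"
    and rho_bounds: "\<And>x. x \<in> \<Omega> \<Longrightarrow> c < \<rho> 0 x + \<rho> 1 x \<and> \<rho> 0 x + \<rho> 1 x < inverse c"
begin

lemma rho01_measurable [measurable]:
  "\<rho> 0 \<in> borel_measurable (leb \<Omega>)" "\<rho> (Suc 0) \<in> borel_measurable (leb \<Omega>)"
  using rho_measurable[of 0] rho_measurable[of 1] by auto

lemma \<Omega>_borel [measurable]: "\<Omega> \<in> sets borel"
  using open_\<Omega> by (rule borel_open)

lemma space_slice [simp]: "i \<in> {0, 1} \<Longrightarrow> space (slice \<Omega> \<mu> i) = \<Omega>"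
  by (simp add: slice_eq space_restrict_space)

lemma sets_slice: "i \<in> {0, 1} \<Longrightarrow> sets (slice \<Omega> \<mu> i) = sets (leb \<Omega>)"
  by (simp add: slice_eq)

lemma measurable_slice [simp]:
  "i \<in> {0, 1} \<Longrightarrow> borel_measurable (slice \<Omega> \<mu> i) = borel_measurable (leb \<Omega>)"
  by (intro measurable_cong_sets sets_slice refl)

lemma AE_leb_iff: "S \<in> sets borel \<Longrightarrow> (AE x in leb S. P x) \<longleftrightarrow> (AE x in lborel. x \<in> S \<longrightarrow> P x)"
  by (subst AE_restrict_space_iff) auto

lemma AE_slice:
  assumes "i \<in> {0, 1}" "AE x in leb \<Omega>. P x"
  shows "AE x in slice \<Omega> \<mu> i. P x"
  using assms rho_measurable[OF assms(1)] unfolding slice_eq[OF assms(1)]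
  by (subst AE_density) (auto elim!: eventually_mono)

lemma borel_subsets_eq: "borel_subsets \<Omega> = sets (leb \<Omega>)"
  by (auto simp: borel_subsets_def sets_restrict_space_iff)

text \<open>\<open>borel_subsets \<Omega>\<close> is already the sigma-algebra of
  \<open>leb \<Omega>\<close>, so it suffices to compare the two set functions on its
  members.\<close>

lemma slice_sum_eq: "slice_sum \<Omega> \<mu> = density (leb \<Omega>) (\<lambda>x. ennreal (\<rho> 0 x + \<rho> 1 x))"
proof -
  have "slice_sum \<Omega> \<mu> = measure_of \<Omega> (borel_subsets \<Omega>)
      (\<lambda>B. \<integral>\<^sup>+ x. ennreal (\<rho> 0 x + \<rho> 1 x) * indicator B x \<partial>leb \<Omega>)"
    unfolding slice_sum_def
  proof (rule measure_of_eq)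
    show "borel_subsets \<Omega> \<subseteq> Pow \<Omega>" by (auto simp: borel_subsets_def)
    fix B assume "B \<in> sigma_sets \<Omega> (borel_subsets \<Omega>)"
    then have B: "B \<in> sets (leb \<Omega>)"
      unfolding borel_subsets_eq using sets.sigma_sets_eq[of "leb \<Omega>"] by (simp add: space_restrict_space)
    have "emeasure (slice \<Omega> \<mu> 0) B + emeasure (slice \<Omega> \<mu> 1) B =
       (\<integral>\<^sup>+ x. ennreal (\<rho> 0 x) * indicator B x + ennreal (\<rho> 1 x) * indicator B x \<partial>leb \<Omega>)"
      using B by (simp add: slice_eq emeasure_density nn_integral_add)
    also have "\<dots> = (\<integral>\<^sup>+ x. ennreal (\<rho> 0 x + \<rho> 1 x) * indicator B x \<partial>leb \<Omega>)"
      using rho_nonneg by (intro nn_integral_cong) (auto simp: space_restrict_space distrib_right)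
    finally show "emeasure (slice \<Omega> \<mu> 0) B + emeasure (slice \<Omega> \<mu> 1) B = \<dots>" .
  qed
  then show ?thesis
    by (simp add: density_def borel_subsets_eq space_restrict_space)
qed

abbreviation "R \<equiv> slice_sum \<Omega> \<mu>"

lemma space_R [simp]: "space R = \<Omega>"
  by (simp add: slice_sum_eq space_restrict_space)

lemma sets_R [measurable_cong]: "sets R = sets (leb \<Omega>)"
  by (simp add: slice_sum_eq)

text \<open>The lower bound \<open>c\<close> on the total density makes the weighted measure
  equivalent to Lebesgue measure, whereas a single slice is in general only absolutely
  continuous.\<close>

lemma AE_R_iff: "(AE x in R. P x) \<longleftrightarrow> (AE x in leb \<Omega>. P x)"
proof -
  have "(AE x in R. P x) \<longleftrightarrow> (AE x in leb \<Omega>. 0 < ennreal (\<rho> 0 x + \<rho> 1 x) \<longrightarrow> P x)"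
    unfolding slice_sum_eq by (subst AE_density) auto
  also have "\<dots> \<longleftrightarrow> (AE x in leb \<Omega>. P x)"
    using rho_bounds c_pos by (intro AE_cong) (force simp: space_restrict_space)
  finally show ?thesis .
qed

lemma measurable_R: "borel_measurable R = borel_measurable (leb \<Omega>)"
  by (intro measurable_cong_sets sets_R refl)

lemma finite_measure_R: "finite_measure R"
proof
  have "emeasure R (space R) = (\<integral>\<^sup>+ x. ennreal (\<rho> 0 x + \<rho> 1 x) * indicator \<Omega> x \<partial>leb \<Omega>)"
    by (simp add: slice_sum_eq emeasure_density space_restrict_space sets_restrict_space_iff)
  also have "\<dots> \<le> (\<integral>\<^sup>+ x. ennreal (inverse c) \<partial>leb \<Omega>)"
    using rho_bounds by (intro nn_integral_mono) (auto simp: space_restrict_space less_imp_le intro!: ennreal_leI)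
  also have "\<dots> = ennreal (inverse c) * emeasure lborel \<Omega>"
    by (simp add: space_restrict_space emeasure_restrict_space)
  also have "\<dots> < \<infinity>"
    using emeasure_bounded_finite[OF bounded_\<Omega>] by (simp add: ennreal_mult_less_top)
  finally show "emeasure R (space R) \<noteq> \<infinity>" by simp
qed

section \<open>Essential suprema over balls\<close>

lemma measurable_leb_subset:
  "u \<in> borel_measurable (leb \<Omega>) \<Longrightarrow> S \<subseteq> \<Omega> \<Longrightarrow> (\<lambda>y. ereal (u y)) \<in> borel_measurable (leb S)"
  using measurable_restrict_mono by (intro borel_measurable_ereal) blast

text \<open>Working criterion for bounds on essential suprema. Stating it with \<open>lborel\<close>
  instead of the restricted measure lets suprema over different sets be compared directly.\<close>

lemma esssup_leb_le_iff:
  assumes "u \<in> borel_measurable (leb \<Omega>)" "S \<subseteq> \<Omega>" "open S"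
  shows "esssup (leb S) (\<lambda>y. ereal (u y)) \<le> t \<longleftrightarrow> (AE y in lborel. y \<in> S \<longrightarrow> ereal (u y) \<le> t)"
proof -
  have S: "S \<in> sets borel" using assms by auto
  show ?thesis
  proof
    assume "esssup (leb S) (\<lambda>y. ereal (u y)) \<le> t"
    then show "AE y in lborel. y \<in> S \<longrightarrow> ereal (u y) \<le> t"
      using esssup_AE[of "\<lambda>y. ereal (u y)" "leb S"] unfolding AE_leb_iff[OF S]
      by (auto elim!: eventually_mono)
  next
    assume "AE y in lborel. y \<in> S \<longrightarrow> ereal (u y) \<le> t"
    then show "esssup (leb S) (\<lambda>y. ereal (u y)) \<le> t"
      using measurable_leb_subset[OF assms(1,2)] by (intro esssup_I) (auto simp: AE_leb_iff[OF S])
  qed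
qed

lemma AE_le_esssup_leb:
  assumes "u \<in> borel_measurable (leb \<Omega>)" "S \<subseteq> \<Omega>" "open S"
  shows "AE y in lborel. y \<in> S \<longrightarrow> ereal (u y) \<le> esssup (leb S) (\<lambda>y. ereal (u y))"
  using esssup_leb_le_iff[OF assms] by blast

abbreviation "nbhd x \<equiv> ball x \<epsilon> \<inter> \<Omega>"

abbreviation "ess u x \<equiv> esssup (leb (nbhd x)) (\<lambda>y. ereal (u y))"

lemma open_nbhd: "open (nbhd x)"
  using open_\<Omega> by auto

lemmas ess_le_iff = esssup_leb_le_iff[OF _ Int_lower2 open_nbhd]
lemmas AE_le_ess = AE_le_esssup_leb[OF _ Int_lower2 open_nbhd]

text \<open>The value \<open>-\<infinity>\<close> for a real function would make
  \<open>nbhd x\<close> a null set, but a nonempty open set is not negligible. This keeps later sums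
  of suprema free of indeterminate forms.\<close>

lemma ess_gt_MInf:
  assumes u: "u \<in> borel_measurable (leb \<Omega>)" and x: "x \<in> \<Omega>"
  shows "ess u x \<noteq> -\<infinity>"
proof
  assume "ess u x = -\<infinity>"
  then have "AE y in lborel. y \<notin> nbhd x"
    using AE_le_ess[OF u, of x] by (auto elim!: eventually_mono)
  then have "nbhd x \<in> null_sets lborel"
    using open_nbhd[of x] by (subst AE_iff_null_sets) auto
  then have "negligible (nbhd x)"
    using open_nbhd[of x] by (simp add: negligible_iff_null_sets null_sets_completion_iff)
  moreover have "nbhd x \<noteq> {}" using x eps_pos centre_in_ball by blast
  ultimately show False using open_nbhd[of x] open_not_negligible by blast
qed

text \<open>The exceptional set in \<open>AE_le_ess\<close> varies with the centre, so it cannot be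
  evaluated at the centre itself. Balls of radius \<open>\<epsilon>/2\<close> about a countable
  dense set share one null set, and every \<open>y\<close> lies in such a ball, which in turn is
  contained in \<open>ball y \<epsilon>\<close>.\<close>

lemma AE_le_ess_self:
  assumes u: "u \<in> borel_measurable (leb \<Omega>)"
  shows "AE x in leb \<Omega>. ereal (u x) \<le> ess u x"
proof -
  obtain D :: "'a set" where D: "countable D" "\<And>X. open X \<Longrightarrow> X \<noteq> {} \<Longrightarrow> \<exists>d\<in>D. d \<in> X"
    by (metis countable_dense_setE)
  have "AE y in lborel. \<forall>d\<in>D. y \<in> ball d (\<epsilon>/2) \<inter> \<Omega> \<longrightarrow>
      ereal (u y) \<le> esssup (leb (ball d (\<epsilon>/2) \<inter> \<Omega>)) (\<lambda>y. ereal (u y))"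
    unfolding AE_ball_countable[OF D(1)]
    by (intro ballI AE_le_esssup_leb[OF u]) (use open_\<Omega> in auto)
  moreover have "ereal (u y) \<le> ess u y" if y: "y \<in> \<Omega>" and le: "\<forall>d\<in>D. y \<in> ball d (\<epsilon>/2) \<inter> \<Omega> \<longrightarrow>
      ereal (u y) \<le> esssup (leb (ball d (\<epsilon>/2) \<inter> \<Omega>)) (\<lambda>y. ereal (u y))" for y
  proof -
    obtain d where d: "d \<in> D" "d \<in> ball y (\<epsilon>/2)"
      using D(2)[of "ball y (\<epsilon>/2)"] eps_pos by auto
    have sub: "ball d (\<epsilon>/2) \<subseteq> ball y \<epsilon>"
    proof
      fix z assume "z \<in> ball d (\<epsilon>/2)"
      then show "z \<in> ball y \<epsilon>"
        using d dist_triangle[of y z d] by (simp add: dist_commute)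
    qed
    have "ereal (u y) \<le> esssup (leb (ball d (\<epsilon>/2) \<inter> \<Omega>)) (\<lambda>y. ereal (u y))"
      using le d y by (auto simp: dist_commute)
    also have "\<dots> \<le> ess u y"
      using AE_le_ess[OF u, of y] sub open_\<Omega>
      by (subst esssup_leb_le_iff[OF u]) (auto elim!: eventually_mono)
    finally show ?thesis .
  qed
  ultimately show ?thesis
    unfolding AE_leb_iff[OF \<Omega>_borel] by (auto elim!: eventually_mono)
qed

text \<open>The map is lower semicontinuous: a supremum above \<open>t\<close> is already seen on a
  slightly smaller ball, and this ball is contained in \<open>ball y \<epsilon>\<close> for all
  \<open>y\<close> near \<open>x\<close>.\<close>

lemma ess_measurable [measurable]:
  assumes u: "u \<in> borel_measurable (leb \<Omega>)"
  shows "(\<lambda>x. ess u x) \<in> borel_measurable (leb \<Omega>)"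
proof -
  have "open {x. t < ess u x}" for t
    unfolding open_dist
  proof clarify
    fix x assume lt: "t < ess u x"
    \<comment> \<open>The smaller balls exhaust \<open>ball x \<epsilon>\<close>. If none of them
      saw values above \<open>t\<close>, the countable union of the exceptional sets would still be
      null, contradicting \<open>lt\<close>.\<close>
    have "\<exists>n::nat. \<not> (AE y in lborel. y \<in> ball x (\<epsilon> - 1 / (real n + 1)) \<inter> \<Omega> \<longrightarrow> ereal (u y) \<le> t)"
    proof (rule ccontr)
      assume "\<not> ?thesis"
      then have "AE y in lborel. \<forall>n::nat. y \<in> ball x (\<epsilon> - 1 / (real n + 1)) \<inter> \<Omega> \<longrightarrow> ereal (u y) \<le> t"
        unfolding AE_all_countable by blast
      then have "AE y in lborel. y \<in> nbhd x \<longrightarrow> ereal (u y) \<le> t"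
      proof (rule eventually_mono, intro impI)
        fix y assume *: "\<forall>n::nat. y \<in> ball x (\<epsilon> - 1 / (real n + 1)) \<inter> \<Omega> \<longrightarrow> ereal (u y) \<le> t"
          and y: "y \<in> nbhd x"
        obtain n where "1 / (real n + 1) < \<epsilon> - dist x y"
          using y reals_Archimedean[of "\<epsilon> - dist x y"] by (auto simp: inverse_eq_divide add.commute)
        with y have "y \<in> ball x (\<epsilon> - 1 / (real n + 1)) \<inter> \<Omega>" by auto
        with * show "ereal (u y) \<le> t" by blast
      qed
      then show False using lt ess_le_iff[OF u, of x t] by auto
    qed
    then obtain n :: nat where
      n: "\<not> (AE y in lborel. y \<in> ball x (\<epsilon> - 1 / (real n + 1)) \<inter> \<Omega> \<longrightarrow> ereal (u y) \<le> t)" ..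
    show "\<exists>e>0. \<forall>y. dist y x < e \<longrightarrow> y \<in> {x. t < ess u x}"
    proof (intro exI[of _ "1 / (real n + 1)"] conjI allI impI)
      fix y assume y: "dist y x < 1 / (real n + 1)"
      have sub: "ball x (\<epsilon> - 1 / (real n + 1)) \<subseteq> ball y \<epsilon>"
      proof
        fix z assume "z \<in> ball x (\<epsilon> - 1 / (real n + 1))"
        then show "z \<in> ball y \<epsilon>" using y dist_triangle[of y z x] by simp
      qed
      have "\<not> (AE z in lborel. z \<in> nbhd y \<longrightarrow> ereal (u z) \<le> t)"
      proof
        assume "AE z in lborel. z \<in> nbhd y \<longrightarrow> ereal (u z) \<le> t"
        then have "AE z in lborel. z \<in> ball x (\<epsilon> - 1 / (real n + 1)) \<inter> \<Omega> \<longrightarrow> ereal (u z) \<le> t"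
          by (rule eventually_mono) (use sub in blast)
        with n show False by contradiction
      qed
      then show "y \<in> {x. t < ess u x}" using ess_le_iff[OF u, of y t] by auto
    qed simp
  qed
  then have "(\<lambda>x. ess u x) \<in> borel_measurable borel"
    unfolding borel_measurable_ereal_iff_Ioi by (auto simp: vimage_def)
  then show ?thesis
    by (simp add: measurable_restrict_space1)
qed

abbreviation "os u x \<equiv> osc \<Omega> \<epsilon> u x"

lemma osc_measurable [measurable]:
  assumes [measurable]: "u \<in> borel_measurable (leb \<Omega>)"
  shows "(\<lambda>x. os u x) \<in> borel_measurable (leb \<Omega>)"
  unfolding osc_def by measurable

text \<open>An essential infimum is minus the essential supremum of \<open>- u\<close>, so every
  property of \<open>TV\<close> reduces to properties of \<open>osc\<close> for \<open>u\<close> and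
  for \<open>- u\<close>.\<close>

lemma TV_eq:
  assumes u: "u \<in> borel_measurable (leb \<Omega>)"
  shows "TV \<Omega> \<mu> \<epsilon> u = ennreal (1 / \<epsilon>) *
    ((\<integral>\<^sup>+ x. os u x \<partial>slice \<Omega> \<mu> 0) + (\<integral>\<^sup>+ x. os (\<lambda>x. - u x) x \<partial>slice \<Omega> \<mu> 1))"
proof -
  have "ereal (u x) - essinf (leb (nbhd x)) (\<lambda>y. ereal (u y)) = ess (\<lambda>x. - u x) x - ereal (- u x)" for x
    using measurable_leb_subset[OF u, of "nbhd x"]
    by (simp add: essinf_eq_esssup_uminus minus_ereal_def add.commute)
  then show ?thesis by (simp add: TV_def osc_def)
qed

section \<open>Pointwise rules for the oscillation\<close>

lemma osc_add:
  assumes u: "u \<in> borel_measurable (leb \<Omega>)" and v: "v \<in> borel_measurable (leb \<Omega>)" and x: "x \<in> \<Omega>"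
  shows "os (\<lambda>x. u x + v x) x \<le> os u x + os v x"
proof -
  have "ess (\<lambda>x. u x + v x) x \<le> ess u x + ess v x"
    using esssup_add[of "leb (nbhd x)" "\<lambda>y. ereal (u y)" "\<lambda>y. ereal (v y)"] by simp
  \<comment> \<open>Regrouping is legitimate because neither supremum on the right is
    \<open>-\<infinity>\<close>.\<close>
  then have "ess (\<lambda>x. u x + v x) x - ereal (u x + v x) \<le> (ess u x - ereal (u x)) + (ess v x - ereal (v x))"
    using ess_gt_MInf[OF u x] ess_gt_MInf[OF v x]
    by (cases "ess (\<lambda>x. u x + v x) x"; cases "ess u x"; cases "ess v x") auto
  then show ?thesis
    unfolding osc_def by (rule order_trans[OF e2ennreal_mono e2ennreal_add_le])
qed

lemma osc_cmult:
  assumes r: "0 < r"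
  shows "os (\<lambda>x. r * u x) x = ennreal r * os u x"
proof -
  have "ess (\<lambda>x. r * u x) x = ereal r * ess u x"
    using esssup_cmult[OF r, of "leb (nbhd x)" "\<lambda>y. ereal (u y)"] by simp
  then have "ess (\<lambda>x. r * u x) x - ereal (r * u x) = ereal r * (ess u x - ereal (u x))"
    using r by (cases "ess u x") (auto simp: algebra_simps)
  then show ?thesis
    unfolding osc_def by (simp add: e2ennreal_cmult[OF r])
qed

lemma osc_le:
  assumes u: "u \<in> borel_measurable (leb \<Omega>)" and b: "\<And>x. x \<in> \<Omega> \<Longrightarrow> a \<le> u x \<and> u x \<le> b" and x: "x \<in> \<Omega>"
  shows "os u x \<le> ennreal (b - a)"
proof -
  have "ess u x \<le> ereal b" using b by (subst ess_le_iff[OF u]) auto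
  then have "ess u x - ereal (u x) \<le> ereal b - ereal a"
    using b[OF x] by (intro ereal_minus_mono) auto
  then show ?thesis unfolding osc_def using e2ennreal_mono by fastforce
qed

text \<open>Nondecreasing functions of the same \<open>u\<close> attain their essential suprema together,
  hence the reverse of the triangle inequality.\<close>

lemma osc_comonotone:
  assumes u: "u \<in> borel_measurable (leb \<Omega>)" and "mono f" "mono g" and fg: "\<And>t. f t + g t = t"
  shows "AE x in leb \<Omega>. os (\<lambda>x. f (u x)) x + os (\<lambda>x. g (u x)) x \<le> os u x"
proof -
  have [measurable]: "f \<in> borel_measurable borel" "g \<in> borel_measurable borel"
    using assms by (auto intro: borel_measurable_mono)
  have fu: "(\<lambda>x. f (u x)) \<in> borel_measurable (leb \<Omega>)" and gu: "(\<lambda>x. g (u x)) \<in> borel_measurable (leb \<Omega>)"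
    using u by auto
  have le: "ess (\<lambda>x. h (u x)) x \<le> ereal (h s)" if "mono h" "(\<lambda>x. h (u x)) \<in> borel_measurable (leb \<Omega>)"
    "ess u x = ereal s" for h s x
    using AE_le_ess[OF u, of x] that by (subst ess_le_iff) (auto elim!: eventually_mono simp: monoD)
  \<comment> \<open>The truncation in \<open>osc\<close> is additive only on nonnegative arguments,
    hence the assumptions \<open>nn\<close>, which hold almost everywhere by
    \<open>AE_le_ess_self\<close>.\<close>
  have *: "os (\<lambda>x. f (u x)) x + os (\<lambda>x. g (u x)) x \<le> os u x"
    if x: "x \<in> \<Omega>" and nn: "ereal (f (u x)) \<le> ess (\<lambda>x. f (u x)) x" "ereal (g (u x)) \<le> ess (\<lambda>x. g (u x)) x" for x
  proof -
    have "(ess (\<lambda>x. f (u x)) x - ereal (f (u x))) + (ess (\<lambda>x. g (u x)) x - ereal (g (u x)))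
        \<le> ess u x - ereal (u x)"
    proof (cases "ess u x")
      case (real s)
      have "ess (\<lambda>x. f (u x)) x + ess (\<lambda>x. g (u x)) x \<le> ereal (f s) + ereal (g s)"
        using le[OF \<open>mono f\<close> fu real] le[OF \<open>mono g\<close> gu real] by (rule add_mono)
      then have "ess (\<lambda>x. f (u x)) x + ess (\<lambda>x. g (u x)) x \<le> ereal s"
        by (simp add: fg)
      then show ?thesis
        using real fg[of "u x"] nn
        by (cases "ess (\<lambda>x. f (u x)) x"; cases "ess (\<lambda>x. g (u x)) x") auto
    qed (use ess_gt_MInf[OF u x] in auto)
    then show ?thesis
      unfolding osc_def using nn
      by (subst e2ennreal_add[symmetric]) (auto intro!: e2ennreal_mono simp: ereal_diff_positive)
  qed
  show ?thesis
    using AE_le_ess_self[OF fu] AE_le_ess_self[OF gu] AE_space[of "leb \<Omega>"]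
    by eventually_elim (auto intro!: * simp: space_restrict_space)
qed

text \<open>Off a single null set all bounds of \<open>un n\<close> by its essential supremum hold
  together, and they pass to the pointwise limit. Hence the essential supremum is lower
  semicontinuous, and the continuous monotone truncation preserves this.\<close>

lemma osc_lsc:
  assumes un: "\<And>n. un n \<in> borel_measurable (leb \<Omega>)" and u: "u \<in> borel_measurable (leb \<Omega>)"
    and lim: "AE x in leb \<Omega>. (\<lambda>n. un n x) \<longlonglongrightarrow> u x"
  shows "AE x in leb \<Omega>. os u x \<le> liminf (\<lambda>n. os (un n) x)"
proof -
  have ess: "ess u x \<le> liminf (\<lambda>n. ess (un n) x)" for x
  proof (subst ess_le_iff[OF u])
    have "AE y in lborel. \<forall>n. y \<in> nbhd x \<longrightarrow> ereal (un n y) \<le> ess (un n) x"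
      unfolding AE_all_countable using AE_le_ess[OF un] by blast
    then show "AE y in lborel. y \<in> nbhd x \<longrightarrow> ereal (u y) \<le> liminf (\<lambda>n. ess (un n) x)"
      using lim unfolding AE_leb_iff[OF \<Omega>_borel]
    proof eventually_elim
      case (elim y)
      show ?case
      proof
        assume y: "y \<in> nbhd x"
        then have "(\<lambda>n. ereal (un n y)) \<longlonglongrightarrow> ereal (u y)" using elim by simp
        then have "ereal (u y) = liminf (\<lambda>n. ereal (un n y))"
          by (rule lim_imp_Liminf[OF trivial_limit_sequentially, symmetric])
        also have "\<dots> \<le> liminf (\<lambda>n. ess (un n) x)"
          using elim y by (intro Liminf_mono always_eventually) auto
        finally show "ereal (u y) \<le> liminf (\<lambda>n. ess (un n) x)" .
      qed
    qed
  qed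
  have "os u x \<le> liminf (\<lambda>n. os (un n) x)" if x: "x \<in> \<Omega>" and l: "(\<lambda>n. un n x) \<longlonglongrightarrow> u x" for x
  proof -
    have "(\<lambda>n. - ereal (un n x)) \<longlonglongrightarrow> - ereal (u x)"
      using l by (simp add: tendsto_minus)
    \<comment> \<open>The subtracted values have a finite limit, so adding the limits inferior
      produces no indeterminate form.\<close>
    then have lm: "liminf (\<lambda>n. - ereal (un n x)) = - ereal (u x)"
      by (simp add: lim_imp_Liminf del: uminus_ereal.simps)
    have "ess u x - ereal (u x) \<le> liminf (\<lambda>n. ess (un n) x) + liminf (\<lambda>n. - ereal (un n x))"
      unfolding lm minus_ereal_def by (intro add_right_mono ess)
    also have "\<dots> \<le> liminf (\<lambda>n. ess (un n) x + - ereal (un n x))"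
      by (rule ereal_liminf_add_mono) (unfold lm, simp)
    finally have "os u x \<le> e2ennreal (liminf (\<lambda>n. ess (un n) x - ereal (un n x)))"
      unfolding osc_def minus_ereal_def by (rule e2ennreal_mono)
    also have "\<dots> = liminf (\<lambda>n. os (un n) x)"
      unfolding osc_def by (rule Liminf_compose_continuous_mono[symmetric])
       (auto intro: continuous_on_e2ennreal monoI e2ennreal_mono)
    finally show ?thesis .
  qed
  then show ?thesis
    using lim AE_space[of "leb \<Omega>"] by (auto elim!: eventually_elim2 simp: space_restrict_space)
qed

section \<open>Rules for the total variation\<close>

lemma TV_add:
  assumes u: "u \<in> borel_measurable (leb \<Omega>)" and v: "v \<in> borel_measurable (leb \<Omega>)"
  shows "TV \<Omega> \<mu> \<epsilon> (\<lambda>x. u x + v x) \<le> TV \<Omega> \<mu> \<epsilon> u + TV \<Omega> \<mu> \<epsilon> v"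
proof -
  have *: "(\<integral>\<^sup>+ x. os (\<lambda>x. u x + v x) x \<partial>slice \<Omega> \<mu> i)
      \<le> (\<integral>\<^sup>+ x. os u x \<partial>slice \<Omega> \<mu> i) + (\<integral>\<^sup>+ x. os v x \<partial>slice \<Omega> \<mu> i)"
    if "i \<in> {0, 1}" "u \<in> borel_measurable (leb \<Omega>)" "v \<in> borel_measurable (leb \<Omega>)" for i u v
    using that by (subst nn_integral_add[symmetric]) (auto intro!: nn_integral_mono osc_add)
  have "TV \<Omega> \<mu> \<epsilon> (\<lambda>x. u x + v x) \<le> ennreal (1 / \<epsilon>) *
      (((\<integral>\<^sup>+ x. os u x \<partial>slice \<Omega> \<mu> 0) + (\<integral>\<^sup>+ x. os v x \<partial>slice \<Omega> \<mu> 0))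
      + ((\<integral>\<^sup>+ x. os (\<lambda>x. - u x) x \<partial>slice \<Omega> \<mu> 1) + (\<integral>\<^sup>+ x. os (\<lambda>x. - v x) x \<partial>slice \<Omega> \<mu> 1)))"
    using *[of 0 u v] *[of 1 "\<lambda>x. - u x" "\<lambda>x. - v x"] u v
    by (subst TV_eq) (auto intro!: mult_left_mono add_mono simp: add.commute)
  also have "\<dots> = TV \<Omega> \<mu> \<epsilon> u + TV \<Omega> \<mu> \<epsilon> v"
    by (simp add: TV_eq u v distrib_left ac_simps)
  finally show ?thesis .
qed

lemma TV_cmult:
  assumes u: "u \<in> borel_measurable (leb \<Omega>)" and r: "0 < r"
  shows "TV \<Omega> \<mu> \<epsilon> (\<lambda>x. r * u x) = ennreal r * TV \<Omega> \<mu> \<epsilon> u"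
proof -
  have *: "(\<integral>\<^sup>+ x. os (\<lambda>x. r * u x) x \<partial>slice \<Omega> \<mu> i) = ennreal r * (\<integral>\<^sup>+ x. os u x \<partial>slice \<Omega> \<mu> i)"
    if "i \<in> {0, 1}" "u \<in> borel_measurable (leb \<Omega>)" for i u
    using that r by (simp add: osc_cmult nn_integral_cmult)
  show ?thesis
    using *[of 0 u] *[of 1 "\<lambda>x. - u x"] u r by (simp add: TV_eq distrib_left ac_simps)
qed

text \<open>Takes the place of a coarea formula: splitting \<open>u\<close> along its values into
  two nondecreasing parts does not increase the total variation.\<close>

lemma TV_comonotone:
  assumes u: "u \<in> borel_measurable (leb \<Omega>)" and fg: "mono f" "mono g" "\<And>t. f t + g t = t"
  shows "TV \<Omega> \<mu> \<epsilon> (\<lambda>x. f (u x)) + TV \<Omega> \<mu> \<epsilon> (\<lambda>x. g (u x)) \<le> TV \<Omega> \<mu> \<epsilon> u"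
proof -
  have *: "(\<integral>\<^sup>+ x. os (\<lambda>x. f (u x)) x \<partial>slice \<Omega> \<mu> i) + (\<integral>\<^sup>+ x. os (\<lambda>x. g (u x)) x \<partial>slice \<Omega> \<mu> i)
      \<le> (\<integral>\<^sup>+ x. os u x \<partial>slice \<Omega> \<mu> i)"
    if i: "i \<in> {0, 1}" and u: "u \<in> borel_measurable (leb \<Omega>)" and fg: "mono f" "mono g" "\<And>t. f t + g t = t"
    for i u f g
  proof -
    have [measurable]: "f \<in> borel_measurable borel" "g \<in> borel_measurable borel"
      using fg by (auto intro: borel_measurable_mono)
    have "(\<integral>\<^sup>+ x. os (\<lambda>x. f (u x)) x \<partial>slice \<Omega> \<mu> i) + (\<integral>\<^sup>+ x. os (\<lambda>x. g (u x)) x \<partial>slice \<Omega> \<mu> i)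
      = (\<integral>\<^sup>+ x. os (\<lambda>x. f (u x)) x + os (\<lambda>x. g (u x)) x \<partial>slice \<Omega> \<mu> i)"
      using i u by (intro nn_integral_add[symmetric]) auto
    also have "\<dots> \<le> (\<integral>\<^sup>+ x. os u x \<partial>slice \<Omega> \<mu> i)"
      by (intro nn_integral_mono_AE AE_slice[OF i] osc_comonotone u fg)
    finally show ?thesis .
  qed
  have [measurable]: "f \<in> borel_measurable borel" "g \<in> borel_measurable borel"
    using fg by (auto intro: borel_measurable_mono)
  have m: "(\<lambda>x. f (u x)) \<in> borel_measurable (leb \<Omega>)" "(\<lambda>x. g (u x)) \<in> borel_measurable (leb \<Omega>)"
    using u by auto
  \<comment> \<open>The second slice sees \<open>- u\<close>, which is split by the conjugate
    functions \<open>\<lambda>t. - f (- t)\<close> and \<open>\<lambda>t. - g (- t)\<close>.\<close>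
  have neg: "mono (\<lambda>t. - f (- t))" "mono (\<lambda>t. - g (- t))" "- f (- t) + - g (- t) = t" for t
    using fg(1,2) fg(3)[of "- t"] by (auto simp: mono_def)
  have "TV \<Omega> \<mu> \<epsilon> (\<lambda>x. f (u x)) + TV \<Omega> \<mu> \<epsilon> (\<lambda>x. g (u x)) = ennreal (1 / \<epsilon>) *
     (((\<integral>\<^sup>+ x. os (\<lambda>x. f (u x)) x \<partial>slice \<Omega> \<mu> 0) + (\<integral>\<^sup>+ x. os (\<lambda>x. g (u x)) x \<partial>slice \<Omega> \<mu> 0)) +
      ((\<integral>\<^sup>+ x. os (\<lambda>x. - f (u x)) x \<partial>slice \<Omega> \<mu> 1) + (\<integral>\<^sup>+ x. os (\<lambda>x. - g (u x)) x \<partial>slice \<Omega> \<mu> 1)))"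
    by (simp add: TV_eq m distrib_left ac_simps)
  also have "\<dots> \<le> TV \<Omega> \<mu> \<epsilon> u"
    using *[OF _ u fg, of 0] *[OF _ _ neg, of 1 "\<lambda>x. - u x"] u
    by (subst TV_eq) (auto intro!: mult_left_mono add_mono)
  finally show ?thesis .
qed

text \<open>Fatou's lemma on each slice. Since convergence is only asked for almost everywhere,
  constant sequences show that \<open>TV\<close> does not depend on the representative.\<close>

lemma TV_lsc:
  assumes un: "\<And>n. un n \<in> borel_measurable (leb \<Omega>)" and u: "u \<in> borel_measurable (leb \<Omega>)"
    and lim: "AE x in leb \<Omega>. (\<lambda>n. un n x) \<longlonglongrightarrow> u x"
  shows "TV \<Omega> \<mu> \<epsilon> u \<le> liminf (\<lambda>n. TV \<Omega> \<mu> \<epsilon> (un n))"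
proof -
  have *: "(\<integral>\<^sup>+ x. os u x \<partial>slice \<Omega> \<mu> i) \<le> liminf (\<lambda>n. \<integral>\<^sup>+ x. os (un n) x \<partial>slice \<Omega> \<mu> i)"
    if "i \<in> {0, 1}" "\<And>n. un n \<in> borel_measurable (leb \<Omega>)" "u \<in> borel_measurable (leb \<Omega>)"
      "AE x in leb \<Omega>. (\<lambda>n. un n x) \<longlonglongrightarrow> u x" for i un u
  proof -
    have "(\<integral>\<^sup>+ x. os u x \<partial>slice \<Omega> \<mu> i) \<le> (\<integral>\<^sup>+ x. liminf (\<lambda>n. os (un n) x) \<partial>slice \<Omega> \<mu> i)"
      using that by (intro nn_integral_mono_AE AE_slice osc_lsc)
    also have "\<dots> \<le> liminf (\<lambda>n. \<integral>\<^sup>+ x. os (un n) x \<partial>slice \<Omega> \<mu> i)"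
      using that by (intro nn_integral_liminf) auto
    finally show ?thesis .
  qed
  have "TV \<Omega> \<mu> \<epsilon> u \<le> ennreal (1 / \<epsilon>) * (liminf (\<lambda>n. \<integral>\<^sup>+ x. os (un n) x \<partial>slice \<Omega> \<mu> 0)
      + liminf (\<lambda>n. \<integral>\<^sup>+ x. os (\<lambda>x. - un n x) x \<partial>slice \<Omega> \<mu> 1))"
    using un u lim unfolding TV_eq[OF u]
    by (intro mult_left_mono add_mono *) (auto intro: tendsto_minus elim!: eventually_mono)
  also have "\<dots> \<le> ennreal (1 / \<epsilon>) * liminf (\<lambda>n. (\<integral>\<^sup>+ x. os (un n) x \<partial>slice \<Omega> \<mu> 0)
      + (\<integral>\<^sup>+ x. os (\<lambda>x. - un n x) x \<partial>slice \<Omega> \<mu> 1))"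
    by (intro mult_left_mono liminf_superadditive_ennreal) simp
  also have "\<dots> \<le> liminf (\<lambda>n. TV \<Omega> \<mu> \<epsilon> (un n))"
    unfolding TV_eq[OF un] using eps_pos by (intro liminf_cmult_ennreal) simp
  finally show ?thesis .
qed

text \<open>Both slices are dominated by the finite measure \<open>R\<close>, and the oscillation by
  \<open>b - a\<close>. In particular every Borel subset of \<open>\<Omega>\<close> has finite
  perimeter, so perimeters can be handled as reals.\<close>

lemma TV_finite:
  assumes u: "u \<in> borel_measurable (leb \<Omega>)" and b: "\<And>x. x \<in> \<Omega> \<Longrightarrow> a \<le> u x \<and> u x \<le> b"
  shows "TV \<Omega> \<mu> \<epsilon> u < \<infinity>"
proof -
  have "emeasure (slice \<Omega> \<mu> i) \<Omega> < \<infinity>" if i: "i \<in> {0, 1}" for i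
  proof -
    have "emeasure (slice \<Omega> \<mu> i) \<Omega> \<le> emeasure R \<Omega>"
      using i rho_measurable[OF i] rho_nonneg unfolding slice_eq[OF i] slice_sum_eq
      by (subst (1 2) emeasure_density)
       (auto simp: sets_restrict_space_iff space_restrict_space intro!: nn_integral_mono mult_right_mono ennreal_leI)
    also have "\<dots> < \<infinity>"
      using finite_measure.emeasure_finite[OF finite_measure_R] by (simp add: less_top)
    finally show ?thesis .
  qed
  then have *: "(\<integral>\<^sup>+ x. os u x \<partial>slice \<Omega> \<mu> i) < \<infinity>"
    if i: "i \<in> {0, 1}" and "u \<in> borel_measurable (leb \<Omega>)" "\<And>x. x \<in> \<Omega> \<Longrightarrow> a \<le> u x \<and> u x \<le> b" for i u a b
  proof -
    have "(\<integral>\<^sup>+ x. os u x \<partial>slice \<Omega> \<mu> i) \<le> (\<integral>\<^sup>+ x. ennreal (b - a) \<partial>slice \<Omega> \<mu> i)"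
      using that by (intro nn_integral_mono osc_le) auto
    also have "\<dots> < \<infinity>"
      using \<open>\<And>i. i \<in> {0, 1} \<Longrightarrow> emeasure (slice \<Omega> \<mu> i) \<Omega> < \<infinity>\<close>[OF i] i
      by (simp add: ennreal_mult_less_top)
    finally show ?thesis .
  qed
  show ?thesis
    using *[of 0 u a b] *[of 1 "\<lambda>x. - u x" "- b" "- a"] u b
    by (auto simp: TV_eq ennreal_mult_less_top)
qed

section \<open>Existence of minimizers\<close>

text \<open>The two-sided bound on the total density makes the square norms for Lebesgue measure and
  for \<open>R\<close> equivalent. From here on integrals are taken with respect to
  \<open>R\<close>, the measure in the energy.\<close>

lemma L2_iff: "u \<in> L2 \<Omega> \<longleftrightarrow> u \<in> borel_measurable (leb \<Omega>) \<and> integrable R (\<lambda>x. (u x)\<^sup>2)"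
proof -
  have "integrable (leb \<Omega>) (\<lambda>x. (u x)\<^sup>2) \<longleftrightarrow> integrable R (\<lambda>x. (u x)\<^sup>2)"
    if [measurable]: "u \<in> borel_measurable (leb \<Omega>)"
  proof -
    let ?r = "\<lambda>x. \<rho> 0 x + \<rho> 1 x"
    have nn: "AE x in leb \<Omega>. 0 \<le> ?r x"
      using rho_nonneg by (intro AE_I2) (auto simp: space_restrict_space)
    have "integrable R (\<lambda>x. (u x)\<^sup>2) \<longleftrightarrow> integrable (leb \<Omega>) (\<lambda>x. ?r x * (u x)\<^sup>2)"
      unfolding slice_sum_eq using nn by (subst integrable_real_density) auto
    also have "\<dots> \<longleftrightarrow> integrable (leb \<Omega>) (\<lambda>x. (u x)\<^sup>2)"
    proof
      assume "integrable (leb \<Omega>) (\<lambda>x. ?r x * (u x)\<^sup>2)"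
      then have "integrable (leb \<Omega>) (\<lambda>x. inverse c * (?r x * (u x)\<^sup>2))" by simp
      then show "integrable (leb \<Omega>) (\<lambda>x. (u x)\<^sup>2)"
      proof (rule Bochner_Integration.integrable_bound)
        show "AE x in leb \<Omega>. norm ((u x)\<^sup>2) \<le> norm (inverse c * (?r x * (u x)\<^sup>2))"
        proof (rule AE_I2)
          fix x assume "x \<in> space (leb \<Omega>)"
          then have "c < ?r x" using rho_bounds by (auto simp: space_restrict_space)
          then have "1 \<le> inverse c * ?r x" using c_pos by (simp add: field_simps)
          then have "1 * (u x)\<^sup>2 \<le> (inverse c * ?r x) * (u x)\<^sup>2" by (intro mult_right_mono) auto
          then show "norm ((u x)\<^sup>2) \<le> norm (inverse c * (?r x * (u x)\<^sup>2))" by (simp add: ac_simps)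
        qed
      qed simp
    next
      assume "integrable (leb \<Omega>) (\<lambda>x. (u x)\<^sup>2)"
      then have "integrable (leb \<Omega>) (\<lambda>x. inverse c * (u x)\<^sup>2)" by simp
      then show "integrable (leb \<Omega>) (\<lambda>x. ?r x * (u x)\<^sup>2)"
      proof (rule Bochner_Integration.integrable_bound)
        show "AE x in leb \<Omega>. norm (?r x * (u x)\<^sup>2) \<le> norm (inverse c * (u x)\<^sup>2)"
        proof (rule AE_I2)
          fix x assume "x \<in> space (leb \<Omega>)"
          then have "0 \<le> ?r x" "?r x \<le> inverse c"
            using rho_bounds rho_nonneg by (auto simp: space_restrict_space less_imp_le)
          then show "norm (?r x * (u x)\<^sup>2) \<le> norm (inverse c * (u x)\<^sup>2)"
            using c_pos by (simp add: abs_mult mult_right_mono)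
        qed
      qed simp
    qed
    finally show ?thesis ..
  qed
  then show ?thesis by (auto simp: L2_def)
qed

section \<open>Linear structure of the weighted space of square integrable functions\<close>

lemma L2_measurable: "u \<in> L2 \<Omega> \<Longrightarrow> u \<in> borel_measurable (leb \<Omega>)"
  by (simp add: L2_def)

lemma L2_integrable_mult:
  assumes "u \<in> L2 \<Omega>" "v \<in> L2 \<Omega>"
  shows "integrable R (\<lambda>x. u x * v x)"
proof (rule Bochner_Integration.integrable_bound[where f = "\<lambda>x. (u x)\<^sup>2 + (v x)\<^sup>2"])
  show "AE x in R. norm (u x * v x) \<le> norm ((u x)\<^sup>2 + (v x)\<^sup>2)"
  proof (rule AE_I2)
    fix x
    have "0 \<le> (\<bar>u x\<bar> - \<bar>v x\<bar>)\<^sup>2" by simp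
    then have "2 * (\<bar>u x\<bar> * \<bar>v x\<bar>) \<le> (u x)\<^sup>2 + (v x)\<^sup>2"
      by (simp add: power2_diff)
    moreover have "0 \<le> \<bar>u x\<bar> * \<bar>v x\<bar>" by simp
    ultimately have "\<bar>u x\<bar> * \<bar>v x\<bar> \<le> (u x)\<^sup>2 + (v x)\<^sup>2" by linarith
    then show "norm (u x * v x) \<le> norm ((u x)\<^sup>2 + (v x)\<^sup>2)" by (simp add: abs_mult)
  qed
qed (use assms in \<open>auto simp: L2_iff measurable_R\<close>)

lemma L2_lincomb:
  assumes u: "u \<in> L2 \<Omega>" and v: "v \<in> L2 \<Omega>"
  shows "(\<lambda>x. a * u x + b * v x) \<in> L2 \<Omega>"
proof -
  have "integrable R (\<lambda>x. a\<^sup>2 * (u x * u x) + 2 * a * b * (u x * v x) + b\<^sup>2 * (v x * v x))"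
    using L2_integrable_mult[OF u u] L2_integrable_mult[OF u v] L2_integrable_mult[OF v v] by simp
  also have "(\<lambda>x. a\<^sup>2 * (u x * u x) + 2 * a * b * (u x * v x) + b\<^sup>2 * (v x * v x))
      = (\<lambda>x. (a * u x + b * v x)\<^sup>2)"
    by (simp add: power2_eq_square algebra_simps)
  finally show ?thesis
    using assms by (auto simp: L2_iff)
qed

lemma L2_bounded:
  assumes u: "u \<in> borel_measurable (leb \<Omega>)" and b: "\<And>x. x \<in> \<Omega> \<Longrightarrow> \<bar>u x\<bar> \<le> K"
  shows "u \<in> L2 \<Omega>"
proof -
  have "norm ((u x)\<^sup>2) \<le> K\<^sup>2" if "x \<in> \<Omega>" for x
    using power_mono[OF b[OF that], of 2] by simp
  then have "integrable R (\<lambda>x. (u x)\<^sup>2)"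
    using u by (intro finite_measure.integrable_const_bound[OF finite_measure_R, where B = "K\<^sup>2"])
      (auto simp: measurable_R intro!: AE_I2)
  then show ?thesis using u by (simp add: L2_iff)
qed

lemma L2_integrable:
  assumes "u \<in> L2 \<Omega>"
  shows "integrable R u"
  using L2_integrable_mult[OF assms L2_bounded[of "\<lambda>_. 1" 1]] by simp

text \<open>By the convention for the empty set both distances lie in
  \<open>[0, diameter \<Omega>]\<close>, so the signed distance is bounded even if a density-one set
  or its complement is empty.\<close>

lemma sdist_L2: "sdist \<Omega> B \<in> L2 \<Omega>"
proof (rule L2_bounded)
  show "sdist \<Omega> B \<in> borel_measurable (leb \<Omega>)"
    unfolding sdist_def[abs_def] by (intro measurable_restrict_space1) simp
  fix x assume x: "x \<in> \<Omega>"
  have "density_one \<Omega> B \<subseteq> \<Omega>" by (auto simp: density_one_def)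
  then show "\<bar>sdist \<Omega> B x\<bar> \<le> diameter \<Omega>"
    using dist_to_le_diameter[OF bounded_\<Omega> _ x] dist_to_nonneg[OF bounded_\<Omega>, of x]
    by (auto simp: sdist_def abs_le_iff intro: order_trans[rotated])
      (smt (verit) Diff_subset)+
qed

section \<open>The one-step energy\<close>

context
  fixes A :: "'a set"
begin

abbreviation "sd \<equiv> sdist \<Omega> (\<Omega> - A)"
abbreviation "energy \<equiv> step_energy \<Omega> \<mu> \<epsilon> A"

lemma L2_diff_sdist: "u \<in> L2 \<Omega> \<Longrightarrow> (\<lambda>x. u x - sd x) \<in> L2 \<Omega>"
  using L2_lincomb[OF _ sdist_L2, of u 1 "-1" "\<Omega> - A"] by simp

lemma step_energy_eq:
  assumes "u \<in> L2 \<Omega>"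
  shows "energy u = ennreal (1 / (2 * \<epsilon>) * (\<integral>x. (u x - sd x)\<^sup>2 \<partial>R)) + TV \<Omega> \<mu> \<epsilon> u"
proof -
  have "integrable R (\<lambda>x. (u x - sd x)\<^sup>2)"
    using L2_diff_sdist[OF assms] by (simp add: L2_iff)
  then have "(\<integral>\<^sup>+ x. ennreal (\<bar>u x - sd x\<bar>\<^sup>2) \<partial>R) = ennreal (\<integral>x. (u x - sd x)\<^sup>2 \<partial>R)"
    by (simp add: nn_integral_eq_integral)
  then show ?thesis
    unfolding step_energy_def using eps_pos by (subst ennreal_mult) auto
qed

text \<open>Fatou's lemma for both parts of the energy. Only measurability is assumed, so the lemma
  applies to a limit whose square integrability is not yet known;
  \<open>L2_of_step_energy_finite\<close> then supplies it.\<close>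

lemma step_energy_lsc:
  assumes un: "\<And>n. un n \<in> borel_measurable (leb \<Omega>)" and u: "u \<in> borel_measurable (leb \<Omega>)"
    and lim: "AE x in leb \<Omega>. (\<lambda>n. un n x) \<longlonglongrightarrow> u x"
  shows "energy u \<le> liminf (\<lambda>n. energy (un n))"
proof -
  let ?f = "\<lambda>u x. ennreal (\<bar>u x - sd x\<bar>\<^sup>2)"
  have m: "?f v \<in> borel_measurable R" if "v \<in> borel_measurable (leb \<Omega>)" for v
    using that L2_measurable[OF sdist_L2, of "\<Omega> - A"] unfolding measurable_R by measurable
  have "(\<integral>\<^sup>+ x. ?f u x \<partial>R) = (\<integral>\<^sup>+ x. liminf (\<lambda>n. ?f (un n) x) \<partial>R)"
  proof (rule nn_integral_cong_AE, unfold AE_R_iff, use lim in eventually_elim)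
    case (elim x)
    then have "(\<lambda>n. ?f (un n) x) \<longlonglongrightarrow> ?f u x" by (intro tendsto_intros)
    then show ?case by (rule lim_imp_Liminf[OF trivial_limit_sequentially, symmetric])
  qed
  also have "\<dots> \<le> liminf (\<lambda>n. \<integral>\<^sup>+ x. ?f (un n) x \<partial>R)"
    by (intro nn_integral_liminf m un)
  finally have "energy u \<le> ennreal (1 / (2 * \<epsilon>)) * liminf (\<lambda>n. \<integral>\<^sup>+ x. ?f (un n) x \<partial>R)
      + liminf (\<lambda>n. TV \<Omega> \<mu> \<epsilon> (un n))"
    unfolding step_energy_def by (intro add_mono mult_left_mono TV_lsc un u lim) auto
  also have "\<dots> \<le> liminf (\<lambda>n. ennreal (1 / (2 * \<epsilon>)) * (\<integral>\<^sup>+ x. ?f (un n) x \<partial>R))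
      + liminf (\<lambda>n. TV \<Omega> \<mu> \<epsilon> (un n))"
    using eps_pos by (intro add_mono liminf_cmult_ennreal) auto
  also have "\<dots> \<le> liminf (\<lambda>n. energy (un n))"
    unfolding step_energy_def by (rule liminf_superadditive_ennreal)
  finally show ?thesis .
qed

lemma L2_of_step_energy_finite:
  assumes u: "u \<in> borel_measurable (leb \<Omega>)" and fin: "energy u < \<infinity>"
  shows "u \<in> L2 \<Omega>"
proof -
  have m: "(\<lambda>x. u x - sd x) \<in> borel_measurable (leb \<Omega>)"
    using u L2_measurable[OF sdist_L2, of "\<Omega> - A"] by measurable
  have "(\<integral>\<^sup>+ x. ennreal (\<bar>u x - sd x\<bar>\<^sup>2) \<partial>R) < \<infinity>"
    using fin eps_pos by (auto simp: step_energy_def ennreal_mult_less_top)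
  then have "integrable R (\<lambda>x. (u x - sd x)\<^sup>2)"
    using m by (intro integrableI_nonneg) (auto simp: measurable_R)
  then have "(\<lambda>x. u x - sd x) \<in> L2 \<Omega>" using m by (simp add: L2_iff)
  from L2_lincomb[OF this sdist_L2, of 1 1 "\<Omega> - A"] show ?thesis by simp
qed

lemma step_energy_zero_finite: "energy (\<lambda>_. 0) < \<infinity>"
  using TV_finite[of "\<lambda>_. 0" 0 0] L2_bounded[of "\<lambda>_. 0" 0] by (subst step_energy_eq) auto

text \<open>Strong convexity: the infimum \<open>m\<close> bounds the energy of the midpoint from below.\<close>

lemma step_energy_midpoint:
  assumes u: "u \<in> L2 \<Omega>" "energy u \<le> ennreal (m + d)" and v: "v \<in> L2 \<Omega>" "energy v \<le> ennreal (m + d)"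
    and m: "\<And>v. v \<in> L2 \<Omega> \<Longrightarrow> ennreal m \<le> energy v" and pos: "0 \<le> m" "0 \<le> d"
  shows "(\<integral>x. (u x - v x)\<^sup>2 \<partial>R) \<le> 8 * \<epsilon> * d"
proof -
  let ?I = "\<lambda>u. 1 / (2 * \<epsilon>) * (\<integral>x. (u x - sd x)\<^sup>2 \<partial>R)"
  define w where "w x = 1/2 * u x + 1/2 * v x" for x
  have w: "w \<in> L2 \<Omega>" unfolding w_def[abs_def] using u v by (intro L2_lincomb)
  have I_nn: "0 \<le> ?I f" for f using eps_pos by simp
  have T: "TV \<Omega> \<mu> \<epsilon> f = ennreal (enn2real (TV \<Omega> \<mu> \<epsilon> f))" "?I f + enn2real (TV \<Omega> \<mu> \<epsilon> f) \<le> m + d"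
    if f: "f \<in> L2 \<Omega>" "energy f \<le> ennreal (m + d)" for f
  proof -
    have "TV \<Omega> \<mu> \<epsilon> f \<le> energy f" by (simp add: step_energy_eq[OF f(1)])
    also have "\<dots> \<le> ennreal (m + d)" by (rule f(2))
    finally have "TV \<Omega> \<mu> \<epsilon> f < top" by (rule le_less_trans) simp
    then show T: "TV \<Omega> \<mu> \<epsilon> f = ennreal (enn2real (TV \<Omega> \<mu> \<epsilon> f))" by simp
    have "ennreal (?I f + enn2real (TV \<Omega> \<mu> \<epsilon> f)) = energy f"
      unfolding step_energy_eq[OF f(1)] using I_nn[of f] by (subst T) (simp add: ennreal_plus)
    then have "ennreal (?I f + enn2real (TV \<Omega> \<mu> \<epsilon> f)) \<le> ennreal (m + d)" using f by simp
    then show "?I f + enn2real (TV \<Omega> \<mu> \<epsilon> f) \<le> m + d" using pos by (subst (asm) ennreal_le_iff) auto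
  qed
  let ?t = "enn2real (TV \<Omega> \<mu> \<epsilon> u)" and ?s = "enn2real (TV \<Omega> \<mu> \<epsilon> v)"
  have mu: "u \<in> borel_measurable (leb \<Omega>)" and mv: "v \<in> borel_measurable (leb \<Omega>)"
    using u v by (auto dest: L2_measurable)
  have "TV \<Omega> \<mu> \<epsilon> w \<le> TV \<Omega> \<mu> \<epsilon> (\<lambda>x. 1/2 * u x) + TV \<Omega> \<mu> \<epsilon> (\<lambda>x. 1/2 * v x)"
    unfolding w_def[abs_def] using mu mv by (intro TV_add) auto
  also have "\<dots> = ennreal (1/2) * TV \<Omega> \<mu> \<epsilon> u + ennreal (1/2) * TV \<Omega> \<mu> \<epsilon> v"
    by (subst (1 2) TV_cmult) (use mu mv in auto)
  also have "\<dots> = ennreal (1/2 * ?t + 1/2 * ?s)"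
    by (subst T(1)[OF u], subst T(1)[OF v])
      (simp only: ennreal_mult[symmetric] ennreal_plus[symmetric] enn2real_nonneg zero_le_divide_1_iff zero_le_numeral mult_nonneg_nonneg)
  finally have TVw: "TV \<Omega> \<mu> \<epsilon> w \<le> ennreal (1/2 * ?t + 1/2 * ?s)" .
  have "ennreal m \<le> energy w" by (rule m[OF w])
  also have "\<dots> \<le> ennreal (?I w) + ennreal (1/2 * ?t + 1/2 * ?s)"
    unfolding step_energy_eq[OF w] by (intro add_mono TVw order_refl)
  also have "\<dots> = ennreal (?I w + (1/2 * ?t + 1/2 * ?s))"
    using I_nn by (intro ennreal_plus[symmetric]) auto
  finally have le: "m \<le> ?I w + (1/2 * ?t + 1/2 * ?s)"
    using I_nn[of w] by (subst (asm) ennreal_le_iff) auto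
  have iu: "integrable R (\<lambda>x. (u x - sd x)\<^sup>2)" and iv: "integrable R (\<lambda>x. (v x - sd x)\<^sup>2)"
    using u v L2_diff_sdist by (auto simp: L2_iff)
  have iuv: "integrable R (\<lambda>x. (u x - v x)\<^sup>2)"
    using L2_lincomb[OF u(1) v(1), of 1 "-1"] by (simp add: L2_iff)
  \<comment> \<open>Parallelogram identity. The weight \<open>1/4\<close> times the prefactor
    \<open>1 / (2 * \<epsilon>)\<close> gives the constant \<open>8 * \<epsilon>\<close> of the
    claim.\<close>
  have "(\<integral>x. (w x - sd x)\<^sup>2 \<partial>R) =
      (\<integral>x. 1/2 * (u x - sd x)\<^sup>2 + 1/2 * (v x - sd x)\<^sup>2 - 1/4 * (u x - v x)\<^sup>2 \<partial>R)"
    unfolding w_def by (intro Bochner_Integration.integral_cong) (auto simp: power2_eq_square field_simps)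
  also have "\<dots> = 1/2 * (\<integral>x. (u x - sd x)\<^sup>2 \<partial>R) + 1/2 * (\<integral>x. (v x - sd x)\<^sup>2 \<partial>R) - 1/4 * (\<integral>x. (u x - v x)\<^sup>2 \<partial>R)"
    using iu iv iuv by simp
  finally have w_sq: "(\<integral>x. (w x - sd x)\<^sup>2 \<partial>R) = \<dots>" .
  have "?I w = 1/2 * ?I u + 1/2 * ?I v - 1 / (8 * \<epsilon>) * (\<integral>x. (u x - v x)\<^sup>2 \<partial>R)"
    unfolding w_sq using eps_pos by (simp add: field_simps)
  then have "1 / (8 * \<epsilon>) * (\<integral>x. (u x - v x)\<^sup>2 \<partial>R) \<le> d"
    using le T(2)[OF u] T(2)[OF v] by linarith
  then show ?thesis using eps_pos by (simp add: field_simps)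
qed

text \<open>Direct method. The midpoint estimate makes a minimizing sequence Cauchy in the square
  norm and, since \<open>R\<close> is finite, in the L1 norm. A subsequence then converges almost
  everywhere, which is what lower semicontinuity of the energy needs.\<close>

lemma minimizer_exists: "\<exists>w\<in>L2 \<Omega>. \<forall>u\<in>L2 \<Omega>. energy w \<le> energy u"
proof -
  have zero: "(\<lambda>_. 0) \<in> L2 \<Omega>" by (rule L2_bounded[where K = 0]) auto
  define m where "m = enn2real (INF u\<in>L2 \<Omega>. energy u)"
  have "(INF u\<in>L2 \<Omega>. energy u) \<le> energy (\<lambda>_. 0)" by (rule INF_lower[OF zero])
  then have "(INF u\<in>L2 \<Omega>. energy u) < top" using step_energy_zero_finite by (auto intro: le_less_trans)
  then have m_eq: "(INF u\<in>L2 \<Omega>. energy u) = ennreal m" by (simp add: m_def)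
  have m0: "0 \<le> m" by (simp add: m_def)
  have m_le: "ennreal m \<le> energy u" if "u \<in> L2 \<Omega>" for u
    unfolding m_eq[symmetric] by (rule INF_lower[OF that])
  have "\<exists>u. u \<in> L2 \<Omega> \<and> energy u < ennreal (m + 1 / (real n + 1))" for n
  proof -
    have "(INF u\<in>L2 \<Omega>. energy u) < ennreal (m + 1 / (real n + 1))"
      unfolding m_eq using m0 by (intro ennreal_lessI) (auto intro: add_nonneg_pos)
    then show ?thesis by (auto simp: INF_less_iff)
  qed
  then obtain un where un: "\<And>n. un n \<in> L2 \<Omega>" "\<And>n. energy (un n) < ennreal (m + 1 / (real n + 1))"
    by metis
  have sq: "(\<integral>x. (un i x - un j x)\<^sup>2 \<partial>R) \<le> 8 * \<epsilon> * (1 / (real N + 1))" if "i \<ge> N" "j \<ge> N" for i j N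
  proof (rule step_energy_midpoint[OF un(1) _ un(1) _ m_le m0])
    have "energy (un k) \<le> ennreal (m + 1 / (real N + 1))" if "k \<ge> N" for k
    proof -
      have "1 / (real k + 1) \<le> 1 / (real N + 1)" using that by (simp add: frac_le)
      then show ?thesis using un(2)[of k] by (meson add_left_mono ennreal_leI less_imp_le order_trans)
    qed
    then show "energy (un i) \<le> ennreal (m + 1 / (real N + 1))" "energy (un j) \<le> ennreal (m + 1 / (real N + 1))"
      using that by auto
  qed auto
  have cauchy: "\<exists>N. \<forall>i\<ge>N. \<forall>j\<ge>N. (\<integral>x. norm (un i x - un j x) \<partial>R) < e" if e: "e > 0" for e
  proof -
    define M where "M = measure R (space R)"
    \<comment> \<open>Parameter of Young's inequality: the norm of the difference is at most
      \<open>d / 2\<close> plus its square over \<open>2 * d\<close>. After integration both terms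
      are at most \<open>e / 2\<close>, the first one strictly less. The summand \<open>1\<close>
      covers \<open>M = 0\<close> and gives \<open>d * M < e\<close>.\<close>
    define d where "d = e / (M + 1)"
    have M: "0 \<le> M" by (simp add: M_def)
    have d: "d > 0" using e M by (simp add: d_def)
    have dM: "d * M < e" using e M by (simp add: d_def field_simps)
    obtain N :: nat where N: "1 / (real N + 1) < d * e / (8 * \<epsilon>)"
      using reals_Archimedean[of "d * e / (8 * \<epsilon>)"] d e eps_pos by (auto simp: inverse_eq_divide add.commute)
    have "(\<integral>x. norm (un i x - un j x) \<partial>R) < e" if ij: "i \<ge> N" "j \<ge> N" for i j
    proof -
      have i1: "(\<lambda>x. un i x - un j x) \<in> L2 \<Omega>"
        using L2_lincomb[OF un(1) un(1), of 1 i "-1" j] by simp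
      have i2: "integrable R (\<lambda>x. (un i x - un j x)\<^sup>2)" using i1 by (simp add: L2_iff)
      have i3: "integrable R (\<lambda>x. d / 2)"
        using finite_measure.integrable_const[OF finite_measure_R] .
      have "(\<integral>x. norm (un i x - un j x) \<partial>R) \<le> (\<integral>x. d / 2 + 1 / (2 * d) * (un i x - un j x)\<^sup>2 \<partial>R)"
      proof (rule integral_mono)
        show "integrable R (\<lambda>x. norm (un i x - un j x))" using L2_integrable[OF i1] by simp
        show "integrable R (\<lambda>x. d / 2 + 1 / (2 * d) * (un i x - un j x)\<^sup>2)" using i2 i3 by simp
        fix x
        have "0 \<le> (\<bar>un i x - un j x\<bar> - d)\<^sup>2" by simp
        then have "2 * d * \<bar>un i x - un j x\<bar> \<le> (un i x - un j x)\<^sup>2 + d * d"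
          by (simp add: power2_diff power2_eq_square[of d] algebra_simps)
        then show "norm (un i x - un j x) \<le> d / 2 + 1 / (2 * d) * (un i x - un j x)\<^sup>2"
          using d by (simp add: field_simps)
      qed
      also have "\<dots> = d / 2 * M + 1 / (2 * d) * (\<integral>x. (un i x - un j x)\<^sup>2 \<partial>R)"
        using i2 i3 by (simp add: M_def)
      also have "\<dots> \<le> d / 2 * M + 1 / (2 * d) * (8 * \<epsilon> * (1 / (real N + 1)))"
        using sq[OF ij] d by (intro add_left_mono mult_left_mono) auto
      also have "8 * \<epsilon> * (1 / (real N + 1)) \<le> d * e"
        using N eps_pos by (simp add: field_simps)
      then have "d / 2 * M + 1 / (2 * d) * (8 * \<epsilon> * (1 / (real N + 1))) \<le> d / 2 * M + 1 / (2 * d) * (d * e)"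
        using d by (intro add_left_mono mult_left_mono) auto
      also have "\<dots> < e" using dM d by simp
      finally show ?thesis .
    qed
    then show ?thesis by blast
  qed
  obtain r where r: "strict_mono r" "AE x in R. Cauchy (\<lambda>i. un (r i) x)"
    by (rule cauchy_L1_AE_cauchy_subseq[of R un, OF L2_integrable[OF un(1)] cauchy])
  \<comment> \<open>On the null set without convergence \<open>lim\<close> has an unspecified value;
    \<open>u\<close> is measurable all the same.\<close>
  define u where "u x = lim (\<lambda>i. un (r i) x)" for x
  have u: "u \<in> borel_measurable (leb \<Omega>)"
    unfolding u_def[abs_def] using L2_measurable[OF un(1)] by (intro borel_measurable_lim_metric)
  have "energy u \<le> liminf (\<lambda>i. energy (un (r i)))"
  proof (rule step_energy_lsc[OF L2_measurable[OF un(1)] u])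
    show "AE x in leb \<Omega>. (\<lambda>n. un (r n) x) \<longlonglongrightarrow> u x"
      using r(2) unfolding AE_R_iff u_def
      by (auto elim!: eventually_mono simp: Cauchy_convergent_iff convergent_LIMSEQ_iff)
  qed
  also have "\<dots> \<le> liminf (\<lambda>i. ennreal (m + 1 / (real i + 1)))"
  proof (intro Liminf_mono always_eventually allI)
    fix i
    have "1 / (real (r i) + 1) \<le> 1 / (real i + 1)"
      using seq_suble[OF r(1), of i] by (simp add: frac_le)
    then show "energy (un (r i)) \<le> ennreal (m + 1 / (real i + 1))"
      using un(2)[of "r i"] by (meson add_left_mono ennreal_leI less_imp_le order_trans)
  qed
  also have "\<dots> = ennreal m"
  proof (rule lim_imp_Liminf[OF trivial_limit_sequentially])
    have "(\<lambda>i. m + 1 / (real i + 1)) \<longlonglongrightarrow> m + 0"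
      using LIMSEQ_inverse_real_of_nat by (intro tendsto_intros) (simp add: inverse_eq_divide add.commute)
    then show "(\<lambda>i. ennreal (m + 1 / (real i + 1))) \<longlonglongrightarrow> ennreal m" by (intro tendsto_ennrealI) simp
  qed
  finally have Eu: "energy u \<le> ennreal m" .
  then have "energy u < \<infinity>" by (auto intro: le_less_trans)
  with u have "u \<in> L2 \<Omega>" by (rule L2_of_step_energy_finite)
  with Eu m_le show ?thesis by (meson order_trans)
qed

text \<open>The choice operator needs a witness. It is obtained from any minimizer by changing it on
  the null set where its positivity set and the density-one set of the latter differ.\<close>

lemma w_star_minimizer:
  "is_arg_min energy (\<lambda>u. u \<in> L2 \<Omega>) (w_star \<Omega> \<mu> \<epsilon> A)"
proof -
  obtain w where w: "w \<in> L2 \<Omega>" and min: "\<And>u. u \<in> L2 \<Omega> \<Longrightarrow> energy w \<le> energy u"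
    using minimizer_exists by blast
  have wm [measurable]: "w \<in> borel_measurable (leb \<Omega>)" using w by (rule L2_measurable)
  define W where "W = {x\<in>\<Omega>. w x > 0}"
  define W1 where "W1 = density_one \<Omega> W"
  \<comment> \<open>The values \<open>1\<close> and \<open>0\<close> merely enforce the sign
    demanded by membership in \<open>W1\<close>.\<close>
  define w' where "w' x = (if x \<in> W1 then if w x > 0 then w x else 1
                           else if w x > 0 then 0 else w x)" for x
  have "W = {x\<in>space (leb \<Omega>). w x > 0}" by (simp add: W_def space_restrict_space)
  also have "\<dots> \<in> sets (leb \<Omega>)" by measurable
  finally have "W \<in> sets (leb \<Omega>)" .
  then have W: "W \<in> sets borel" "W \<subseteq> \<Omega>" by (auto simp: sets_restrict_space_iff)
  have W1: "W1 \<in> sets borel" "W1 \<subseteq> \<Omega>"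
    unfolding W1_def using density_one_borel[OF W(1) \<Omega>_borel] by (auto simp: density_one_def)
  then have [measurable]: "W1 \<in> sets (leb \<Omega>)" by (simp add: sets_restrict_space_iff)
  have w'm: "w' \<in> borel_measurable (leb \<Omega>)" unfolding w'_def[abs_def] by measurable
  have eq: "AE x in leb \<Omega>. w' x = w x"
    unfolding AE_leb_iff[OF \<Omega>_borel]
    using density_one_AE_eq[OF W open_\<Omega> bounded_\<Omega>]
    by eventually_elim (auto simp: w'_def W_def W1_def)
  \<comment> \<open>The constant sequence \<open>w\<close> converges to \<open>w'\<close> almost
    everywhere, so lower semicontinuity compares the energies of two representatives.\<close>
  have "energy w' \<le> liminf (\<lambda>n::nat. energy w)"
    using eq by (intro step_energy_lsc wm w'm) (auto elim!: eventually_mono)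
  then have le: "energy w' \<le> energy w" by (simp add: Liminf_const)
  have "energy w \<le> energy (\<lambda>_. 0)" by (rule min, rule L2_bounded[where K = 0]) auto
  then have "energy w < \<infinity>" using step_energy_zero_finite by (rule le_less_trans)
  with le have "energy w' < \<infinity>" by (rule le_less_trans)
  with w'm have w': "w' \<in> L2 \<Omega>" by (rule L2_of_step_energy_finite)
  have pos: "{x\<in>\<Omega>. w' x > 0} = W1" using W1 by (auto simp: w'_def)
  have "is_arg_min energy (\<lambda>u. u \<in> L2 \<Omega>) w' \<and> {x\<in>\<Omega>. w' x > 0} = density_one \<Omega> {x\<in>\<Omega>. w' x > 0}"
    unfolding pos using w' le min density_one_idem[OF W open_\<Omega> bounded_\<Omega>]
    by (auto simp: is_arg_min_def W1_def not_less intro: order_trans)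
  then show ?thesis
    unfolding w_star_def by (rule someI2[where Q = "is_arg_min energy (\<lambda>u. u \<in> L2 \<Omega>)"]) blast
qed

section \<open>First variation\<close>

text \<open>Compare \<open>w\<close> with \<open>w + s v\<close>, divide by \<open>s\<close> and let
  \<open>s\<close> tend to zero; the quadratic remainder disappears. Differentiability of
  \<open>TV\<close> is replaced by an affine upper bound of slope \<open>t\<close>. As
  \<open>t\<close> may be negative, \<open>nn\<close> keeps that bound faithful when it is read in
  \<open>ennreal\<close>.\<close>

lemma minimizer_variation:
  assumes w: "w \<in> L2 \<Omega>" and min: "\<And>u. u \<in> L2 \<Omega> \<Longrightarrow> energy w \<le> energy u" and v: "v \<in> L2 \<Omega>"
    and TVw: "TV \<Omega> \<mu> \<epsilon> w = ennreal T" "0 \<le> T"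
    and TVv: "\<And>s. 0 < s \<Longrightarrow> s < 1 \<Longrightarrow> TV \<Omega> \<mu> \<epsilon> (\<lambda>x. w x + s * v x) \<le> ennreal (T + s * t)"
    and nn: "\<And>s. 0 < s \<Longrightarrow> s < 1 \<Longrightarrow> 0 \<le> T + s * t"
  shows "(\<integral>x. (sd x - w x) / \<epsilon> * v x \<partial>R) \<le> t"
proof -
  let ?a = "\<integral>x. (w x - sd x) * v x \<partial>R" and ?b = "\<integral>x. (v x)\<^sup>2 \<partial>R"
  have iw: "integrable R (\<lambda>x. (w x - sd x)\<^sup>2)" using L2_diff_sdist[OF w] by (simp add: L2_iff)
  have iwv: "integrable R (\<lambda>x. (w x - sd x) * v x)" by (rule L2_integrable_mult[OF L2_diff_sdist[OF w] v])
  have iv: "integrable R (\<lambda>x. (v x)\<^sup>2)" using v by (simp add: L2_iff)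
  have *: "0 \<le> t + ?a / \<epsilon> + s * (?b / (2 * \<epsilon>))" if s: "0 < s" "s < 1" for s
  proof -
    have L2: "(\<lambda>x. w x + s * v x) \<in> L2 \<Omega>" using L2_lincomb[OF w v, of 1 s] by simp
    let ?I = "\<integral>x. (w x + s * v x - sd x)\<^sup>2 \<partial>R" and ?J = "\<integral>x. (w x - sd x)\<^sup>2 \<partial>R"
    have nnI: "0 \<le> 1 / (2 * \<epsilon>) * ?I" "0 \<le> 1 / (2 * \<epsilon>) * ?J" using eps_pos by auto
    have "ennreal (1 / (2 * \<epsilon>) * ?J + T) = energy w"
      unfolding step_energy_eq[OF w] TVw(1) using nnI TVw(2) by (intro ennreal_plus)
    also have "\<dots> \<le> energy (\<lambda>x. w x + s * v x)" by (rule min[OF L2])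
    also have "\<dots> \<le> ennreal (1 / (2 * \<epsilon>) * ?I) + ennreal (T + s * t)"
      unfolding step_energy_eq[OF L2] by (intro add_left_mono TVv s)
    also have "\<dots> = ennreal (1 / (2 * \<epsilon>) * ?I + (T + s * t))"
      using nnI nn[OF s] by (intro ennreal_plus[symmetric])
    finally have "1 / (2 * \<epsilon>) * ?J + T \<le> 1 / (2 * \<epsilon>) * ?I + (T + s * t)"
      using add_nonneg_nonneg[OF nnI(1) nn[OF s]] by (subst (asm) ennreal_le_iff) auto
    moreover have "?I = (\<integral>x. (w x - sd x)\<^sup>2 + 2 * s * ((w x - sd x) * v x) + s\<^sup>2 * (v x)\<^sup>2 \<partial>R)"
      by (intro Bochner_Integration.integral_cong) (auto simp: power2_eq_square algebra_simps)
    then have "?I = ?J + 2 * s * ?a + s\<^sup>2 * ?b"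
      using iw iwv iv by simp
    ultimately have "0 \<le> 1 / (2 * \<epsilon>) * (2 * s * ?a + s\<^sup>2 * ?b) + s * t"
      by (simp add: algebra_simps)
    also have "\<dots> = s * (t + ?a / \<epsilon> + s * (?b / (2 * \<epsilon>)))"
      using eps_pos by (simp add: field_simps power2_eq_square)
    finally show ?thesis using s by (simp add: zero_le_mult_iff)
  qed
  have "((\<lambda>s. t + ?a / \<epsilon> + s * (?b / (2 * \<epsilon>))) \<longlongrightarrow> t + ?a / \<epsilon> + 0 * (?b / (2 * \<epsilon>))) (at_right 0)"
    by (intro tendsto_intros)
  moreover have "\<forall>\<^sub>F s in at_right 0. 0 \<le> t + ?a / \<epsilon> + s * (?b / (2 * \<epsilon>))"
    using * by (auto simp: eventually_at_right_field intro!: exI[of _ 1])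
  ultimately have "0 \<le> t + ?a / \<epsilon> + 0 * (?b / (2 * \<epsilon>))"
    by (rule tendsto_lowerbound) simp
  moreover have "(\<integral>x. (sd x - w x) / \<epsilon> * v x \<partial>R) = (\<integral>x. - (1 / \<epsilon>) * ((w x - sd x) * v x) \<partial>R)"
    by (intro Bochner_Integration.integral_cong)
      (auto simp: diff_divide_distrib left_diff_distrib)
  ultimately show ?thesis using iwv by simp
qed

end

section \<open>The level set of the minimizer\<close>

lemma indicator_measurable_leb: "E \<in> borel_subsets \<Omega> \<Longrightarrow> indicat_real E \<in> borel_measurable (leb \<Omega>)"
  unfolding borel_subsets_eq by (rule borel_measurable_indicator)

lemma indicator_L2: "E \<in> borel_subsets \<Omega> \<Longrightarrow> indicat_real E \<in> L2 \<Omega>"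
  by (rule L2_bounded[where K = 1]) (auto simp: indicator_measurable_leb indicator_def)

lemma Per_eq_real: "E \<in> borel_subsets \<Omega> \<Longrightarrow> Per \<Omega> \<mu> \<epsilon> E = ennreal (enn2real (Per \<Omega> \<mu> \<epsilon> E))"
  using TV_finite[OF indicator_measurable_leb, of E 0 1] by (simp add: Per_def indicator_def)

text \<open>By the sign in \<open>sdist_compl\<close>, the absolute value times the boundary
  distance equals the difference of the indicators of \<open>A\<close> and \<open>E\<close> times
  the signed distance, almost everywhere. So the fidelity term is affine in the indicator of
  \<open>E\<close>.\<close>

lemma fidelity_eq:
  assumes A: "A \<in> borel_subsets \<Omega>" and E: "E \<in> borel_subsets \<Omega>"
  defines "f \<equiv> (\<integral>x. indicat_real A x * (sdist \<Omega> (\<Omega> - A) x / \<epsilon>) \<partial>R)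
      - (\<integral>x. indicat_real E x * (sdist \<Omega> (\<Omega> - A) x / \<epsilon>) \<partial>R)"
  shows "(\<integral>\<^sup>+ x. ennreal (\<bar>indicat_real E x - indicat_real A x\<bar> * (bdist \<Omega> A x / \<epsilon>)) \<partial>R) = ennreal f"
    and "0 \<le> f"
proof -
  let ?g = "sdist \<Omega> (\<Omega> - A)"
  have int: "integrable R (\<lambda>x. indicat_real B x * (?g x / \<epsilon>))" if "B \<in> borel_subsets \<Omega>" for B
    using L2_integrable_mult[OF indicator_L2[OF that] sdist_L2, of "\<Omega> - A"] by simp
  have bA: "A \<in> sets borel" "A \<subseteq> \<Omega>" using A by (auto simp: borel_subsets_def)
  have eq: "AE x in R. \<bar>indicat_real E x - indicat_real A x\<bar> * (bdist \<Omega> A x / \<epsilon>)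
      = indicat_real A x * (?g x / \<epsilon>) - indicat_real E x * (?g x / \<epsilon>)"
    unfolding AE_R_iff AE_leb_iff[OF \<Omega>_borel]
    using density_one_AE_eq[OF bA open_\<Omega> bounded_\<Omega>]
    by eventually_elim
      (auto simp: sdist_compl[OF bA open_\<Omega> bounded_\<Omega>] indicator_def)
  have bdist0: "0 \<le> bdist \<Omega> A x" for x
    by (simp add: bdist_def dist_to_nonneg[OF bounded_\<Omega>])
  have nn: "AE x in R. 0 \<le> indicat_real A x * (?g x / \<epsilon>) - indicat_real E x * (?g x / \<epsilon>)"
    using eq by eventually_elim (metis abs_ge_zero bdist0 divide_nonneg_pos eps_pos mult_nonneg_nonneg)
  have i: "integrable R (\<lambda>x. indicat_real A x * (?g x / \<epsilon>) - indicat_real E x * (?g x / \<epsilon>))"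
    by (rule Bochner_Integration.integrable_diff[OF int[OF A] int[OF E]])
  have f: "f = (\<integral>x. indicat_real A x * (?g x / \<epsilon>) - indicat_real E x * (?g x / \<epsilon>) \<partial>R)"
    unfolding f_def by (rule Bochner_Integration.integral_diff[OF int[OF A] int[OF E], symmetric])
  show "0 \<le> f" unfolding f by (rule integral_nonneg_AE[OF nn])
  show "(\<integral>\<^sup>+ x. ennreal (\<bar>indicat_real E x - indicat_real A x\<bar> * (bdist \<Omega> A x / \<epsilon>)) \<partial>R) = ennreal f"
    unfolding f nn_integral_eq_integral[OF i nn, symmetric]
    using eq by (intro nn_integral_cong_AE) (auto elim!: eventually_mono)
qed

lemma minimizer_TV_real:
  assumes w: "w \<in> L2 \<Omega>" and min: "\<And>u. u \<in> L2 \<Omega> \<Longrightarrow> step_energy \<Omega> \<mu> \<epsilon> A w \<le> step_energy \<Omega> \<mu> \<epsilon> A u"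
  shows "TV \<Omega> \<mu> \<epsilon> w = ennreal (enn2real (TV \<Omega> \<mu> \<epsilon> w))"
proof -
  have "TV \<Omega> \<mu> \<epsilon> w \<le> step_energy \<Omega> \<mu> \<epsilon> A w" by (simp add: step_energy_eq[OF w])
  also have "\<dots> \<le> step_energy \<Omega> \<mu> \<epsilon> A (\<lambda>_. 0)" by (rule min, rule L2_bounded[where K = 0]) auto
  finally have "TV \<Omega> \<mu> \<epsilon> w < \<infinity>" using step_energy_zero_finite by (rule le_less_trans)
  then show ?thesis by simp
qed

text \<open>Variation in the direction of the indicator of \<open>E\<close>: subadditivity and
  homogeneity of \<open>TV\<close> provide the affine bound, with the perimeter as slope.\<close>

lemma minimizer_Per_ge:
  assumes w: "w \<in> L2 \<Omega>" and min: "\<And>u. u \<in> L2 \<Omega> \<Longrightarrow> step_energy \<Omega> \<mu> \<epsilon> A w \<le> step_energy \<Omega> \<mu> \<epsilon> A u"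
    and E: "E \<in> borel_subsets \<Omega>"
  shows "(\<integral>x. (sdist \<Omega> (\<Omega> - A) x - w x) / \<epsilon> * indicat_real E x \<partial>R) \<le> enn2real (Per \<Omega> \<mu> \<epsilon> E)"
proof (rule minimizer_variation[OF w min indicator_L2[OF E] minimizer_TV_real[OF w min]])
  fix s :: real assume s: "0 < s" "s < 1"
  have "TV \<Omega> \<mu> \<epsilon> (\<lambda>x. w x + s * indicat_real E x)
      \<le> TV \<Omega> \<mu> \<epsilon> w + TV \<Omega> \<mu> \<epsilon> (\<lambda>x. s * indicat_real E x)"
    using L2_measurable[OF w] indicator_measurable_leb[OF E] by (intro TV_add) auto
  also have "TV \<Omega> \<mu> \<epsilon> (\<lambda>x. s * indicat_real E x) = ennreal s * Per \<Omega> \<mu> \<epsilon> E"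
    unfolding Per_def by (rule TV_cmult[OF indicator_measurable_leb[OF E] s(1)])
  also have "\<dots> = ennreal (s * enn2real (Per \<Omega> \<mu> \<epsilon> E))"
    using s by (subst Per_eq_real[OF E]) (simp add: ennreal_mult)
  also have "TV \<Omega> \<mu> \<epsilon> w + \<dots> = ennreal (enn2real (TV \<Omega> \<mu> \<epsilon> w) + s * enn2real (Per \<Omega> \<mu> \<epsilon> E))"
    using s by (subst minimizer_TV_real[OF w min]) (auto intro: ennreal_plus[symmetric])
  finally show "TV \<Omega> \<mu> \<epsilon> (\<lambda>x. w x + s * indicat_real E x)
      \<le> ennreal (enn2real (TV \<Omega> \<mu> \<epsilon> w) + s * enn2real (Per \<Omega> \<mu> \<epsilon> E))" .
qed auto

text \<open>Variation in the direction \<open>- h\<close>. Both \<open>w - s h\<close> and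
  \<open>s h\<close> are nondecreasing functions of \<open>w\<close>, so
  \<open>TV_comonotone\<close> provides an affine bound with the negative slope
  \<open>- TV h\<close>.\<close>

lemma minimizer_truncation_TV_le:
  assumes w: "w \<in> L2 \<Omega>" and min: "\<And>u. u \<in> L2 \<Omega> \<Longrightarrow> step_energy \<Omega> \<mu> \<epsilon> A w \<le> step_energy \<Omega> \<mu> \<epsilon> A u"
    and d: "0 < d"
  defines "h \<equiv> \<lambda>x. min (max (w x) 0) d"
  shows "TV \<Omega> \<mu> \<epsilon> h \<le> ennreal (\<integral>x. (sdist \<Omega> (\<Omega> - A) x - w x) / \<epsilon> * h x \<partial>R)"
    and "0 \<le> (\<integral>x. (sdist \<Omega> (\<Omega> - A) x - w x) / \<epsilon> * h x \<partial>R)"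
proof -
  have wm [measurable]: "w \<in> borel_measurable (leb \<Omega>)" by (rule L2_measurable[OF w])
  have hm: "h \<in> borel_measurable (leb \<Omega>)" unfolding h_def by measurable
  have h: "h \<in> L2 \<Omega>" using d by (intro L2_bounded[OF hm, of d]) (auto simp: h_def)
  have "TV \<Omega> \<mu> \<epsilon> h < \<infinity>" using d by (intro TV_finite[OF hm, of 0 d]) (auto simp: h_def)
  then have TVh: "TV \<Omega> \<mu> \<epsilon> h = ennreal (enn2real (TV \<Omega> \<mu> \<epsilon> h))" by simp
  let ?T = "enn2real (TV \<Omega> \<mu> \<epsilon> w)" and ?t = "enn2real (TV \<Omega> \<mu> \<epsilon> h)"
  have split: "TV \<Omega> \<mu> \<epsilon> (\<lambda>x. w x + s * - h x) + ennreal (s * ?t) \<le> ennreal ?T" if s: "0 < s" "s < 1" for s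
  proof -
    let ?k = "\<lambda>t::real. min (max t 0) d"
    \<comment> \<open>The truncation \<open>?k\<close> is nondecreasing and 1-Lipschitz, so
      subtracting \<open>s < 1\<close> times it preserves monotonicity.\<close>
    have "t + s * - ?k t \<le> t' + s * - ?k t'" if "t \<le> t'" for t t'
    proof -
      have "?k t' - ?k t \<le> t' - t" "0 \<le> ?k t' - ?k t" using that d by auto
      moreover from this s have "s * (?k t' - ?k t) \<le> 1 * (t' - t)" by (intro mult_mono) auto
      ultimately show ?thesis by (simp add: algebra_simps)
    qed
    moreover have "s * ?k t \<le> s * ?k t'" if "t \<le> t'" for t t'
      using that s by (intro mult_left_mono) auto
    ultimately have le: "TV \<Omega> \<mu> \<epsilon> (\<lambda>x. w x + s * - h x) + TV \<Omega> \<mu> \<epsilon> (\<lambda>x. s * h x) \<le> TV \<Omega> \<mu> \<epsilon> w"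
      unfolding h_def
      by (intro TV_comonotone[OF wm, of "\<lambda>t. t + s * - ?k t" "\<lambda>t. s * ?k t"]) (auto intro!: monoI)
    have "TV \<Omega> \<mu> \<epsilon> (\<lambda>x. s * h x) = ennreal (s * ?t)"
      unfolding TV_cmult[OF hm s(1)] using s by (subst TVh) (simp add: ennreal_mult)
    from le[unfolded this] show ?thesis
      by (subst minimizer_TV_real[OF w min, symmetric])
  qed
  \<comment> \<open>Subtraction in \<open>ennreal\<close> is cut off at zero; this bound ensures
    that no cut-off occurs in \<open>?T - s * ?t\<close>.\<close>
  have st: "s * ?t \<le> ?T" if s: "0 < s" "s < 1" for s
  proof -
    have "ennreal (s * ?t) \<le> TV \<Omega> \<mu> \<epsilon> (\<lambda>x. w x + s * - h x) + ennreal (s * ?t)" by simp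
    also have "\<dots> \<le> ennreal ?T" by (rule split[OF s])
    finally show ?thesis by simp
  qed
  have neg_h: "(\<lambda>x. - h x) \<in> L2 \<Omega>" using L2_lincomb[OF h h, of "-1" 0] by simp
  have "(\<integral>x. (sdist \<Omega> (\<Omega> - A) x - w x) / \<epsilon> * - h x \<partial>R) \<le> - ?t"
  proof (rule minimizer_variation[OF w min neg_h minimizer_TV_real[OF w min]])
    fix s :: real assume s: "0 < s" "s < 1"
    show "0 \<le> ?T + s * - ?t" using st[OF s] by simp
    have "TV \<Omega> \<mu> \<epsilon> (\<lambda>x. w x + s * - h x) \<le> ennreal ?T - ennreal (s * ?t)"
      using split[OF s] by (simp add: ennreal_le_minus_iff add.commute)
    also have "\<dots> = ennreal (?T + s * - ?t)"
      using s by (simp add: ennreal_minus)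
    finally show "TV \<Omega> \<mu> \<epsilon> (\<lambda>x. w x + s * - h x) \<le> ennreal (?T + s * - ?t)" .
  qed auto
  then have t: "?t \<le> (\<integral>x. (sdist \<Omega> (\<Omega> - A) x - w x) / \<epsilon> * h x \<partial>R)" by simp
  then show "TV \<Omega> \<mu> \<epsilon> h \<le> ennreal (\<integral>x. (sdist \<Omega> (\<Omega> - A) x - w x) / \<epsilon> * h x \<partial>R)"
    by (subst TVh) (rule ennreal_leI)
  show "0 \<le> (\<integral>x. (sdist \<Omega> (\<Omega> - A) x - w x) / \<epsilon> * h x \<partial>R)"
    using t enn2real_nonneg by (rule order_trans[rotated])
qed

text \<open>Rescaled truncations of \<open>w\<close> converge to the indicator of \<open>W\<close>.
  In the truncation estimate the left side passes to the limit by lower semicontinuity and the right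
  side by dominated convergence.\<close>

lemma minimizer_Per_le:
  assumes w: "w \<in> L2 \<Omega>" and min: "\<And>u. u \<in> L2 \<Omega> \<Longrightarrow> step_energy \<Omega> \<mu> \<epsilon> A w \<le> step_energy \<Omega> \<mu> \<epsilon> A u"
  defines "W \<equiv> {x\<in>\<Omega>. w x > 0}"
  shows "enn2real (Per \<Omega> \<mu> \<epsilon> W) \<le> (\<integral>x. (sdist \<Omega> (\<Omega> - A) x - w x) / \<epsilon> * indicat_real W x \<partial>R)"
proof -
  let ?p = "\<lambda>x. (sdist \<Omega> (\<Omega> - A) x - w x) / \<epsilon>"
  \<comment> \<open>The truncation at height \<open>1 / (n + 1)\<close>, rescaled to height one; it
    equals one as soon as \<open>w x\<close> exceeds that height.\<close>
  define k where "k n x = (real n + 1) * min (max (w x) 0) (1 / (real n + 1))" for n :: nat and x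
  have wm [measurable]: "w \<in> borel_measurable (leb \<Omega>)" by (rule L2_measurable[OF w])
  have pm [measurable]: "?p \<in> borel_measurable (leb \<Omega>)"
    using L2_measurable[OF sdist_L2, of "\<Omega> - A"] by measurable
  have pi: "integrable R ?p"
    using L2_integrable[OF L2_lincomb[OF sdist_L2 w, of 1 "\<Omega> - A" "-1"]] by simp
  have "W = {x\<in>space (leb \<Omega>). w x > 0}" by (simp add: W_def space_restrict_space)
  also have "\<dots> \<in> sets (leb \<Omega>)" by measurable
  finally have W [measurable]: "W \<in> sets (leb \<Omega>)" .
  have km: "k n \<in> borel_measurable (leb \<Omega>)" for n unfolding k_def[abs_def] by measurable
  have k01: "\<bar>k n x\<bar> \<le> 1" for n x
  proof -
    have "0 \<le> k n x" by (simp add: k_def)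
    moreover have "k n x \<le> (real n + 1) * (1 / (real n + 1))"
      unfolding k_def by (intro mult_left_mono) auto
    ultimately show ?thesis by simp
  qed
  have lim: "(\<lambda>n. k n x) \<longlonglongrightarrow> indicat_real W x" if x: "x \<in> \<Omega>" for x
  proof (cases "w x > 0")
    case True
    obtain N :: nat where N: "1 / (real N + 1) < w x"
      using reals_Archimedean[OF True] by (auto simp: inverse_eq_divide add.commute)
    have "k n x = 1" if "n \<ge> N" for n
    proof -
      have "1 / (real n + 1) \<le> 1 / (real N + 1)" using that by (simp add: frac_le)
      then have "min (max (w x) 0) (1 / (real n + 1)) = 1 / (real n + 1)" using N by auto
      then show ?thesis by (simp add: k_def)
    qed
    then have "\<forall>\<^sub>F n in sequentially. k n x = 1" by (auto simp: eventually_sequentially)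
    then show ?thesis using True x by (simp add: W_def tendsto_eventually)
  qed (simp add: W_def k_def)
  have TVk: "TV \<Omega> \<mu> \<epsilon> (k n) \<le> ennreal (\<integral>x. ?p x * k n x \<partial>R)"
    and pk_nn: "0 \<le> (\<integral>x. ?p x * k n x \<partial>R)" for n
  proof -
    let ?h = "\<lambda>x. min (max (w x) 0) (1 / (real n + 1))"
    have eq: "(real n + 1) * (\<integral>x. ?p x * ?h x \<partial>R) = (\<integral>x. ?p x * k n x \<partial>R)"
      unfolding integral_mult_right_zero[symmetric]
      by (intro Bochner_Integration.integral_cong) (auto simp: k_def)
    have "0 \<le> (\<integral>x. ?p x * ?h x \<partial>R)"
      by (rule minimizer_truncation_TV_le(2)[OF w min]) auto
    then show "0 \<le> (\<integral>x. ?p x * k n x \<partial>R)"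
      unfolding eq[symmetric] by (intro mult_nonneg_nonneg) auto
    have "TV \<Omega> \<mu> \<epsilon> (k n) = ennreal (real n + 1) * TV \<Omega> \<mu> \<epsilon> ?h"
      unfolding k_def[abs_def] by (intro TV_cmult) auto
    also have "\<dots> \<le> ennreal (real n + 1) * ennreal (\<integral>x. ?p x * ?h x \<partial>R)"
      by (intro mult_left_mono minimizer_truncation_TV_le(1) w min) auto
    also have "\<dots> = ennreal ((real n + 1) * (\<integral>x. ?p x * ?h x \<partial>R))"
      by (intro ennreal_mult'[symmetric]) auto
    finally show "TV \<Omega> \<mu> \<epsilon> (k n) \<le> ennreal (\<integral>x. ?p x * k n x \<partial>R)" unfolding eq .
  qed
  have limI: "(\<lambda>n. \<integral>x. ?p x * k n x \<partial>R) \<longlonglongrightarrow> (\<integral>x. ?p x * indicat_real W x \<partial>R)"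
  proof (rule integral_dominated_convergence[where w = "\<lambda>x. norm (?p x)"])
    show "AE x in R. (\<lambda>n. ?p x * k n x) \<longlonglongrightarrow> ?p x * indicat_real W x"
      using lim by (intro AE_I2 tendsto_intros) auto
    show "AE x in R. norm (?p x * k n x) \<le> norm (?p x)" for n
      using mult_left_mono[OF k01 abs_ge_zero[of "?p _"]] by (intro AE_I2) (simp add: abs_mult)
    show "integrable R (\<lambda>x. norm (?p x))" using pi by (rule integrable_norm)
    show "(\<lambda>x. ?p x * indicat_real W x) \<in> borel_measurable R"
      unfolding measurable_R by measurable
    show "(\<lambda>x. ?p x * k n x) \<in> borel_measurable R" for n
      unfolding measurable_R by (rule borel_measurable_times[OF pm km])
  qed
  have "Per \<Omega> \<mu> \<epsilon> W \<le> liminf (\<lambda>n. TV \<Omega> \<mu> \<epsilon> (k n))"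
    unfolding Per_def
    using lim by (intro TV_lsc km borel_measurable_indicator W AE_I2) (auto simp: space_restrict_space)
  also have "\<dots> \<le> liminf (\<lambda>n. ennreal (\<integral>x. ?p x * k n x \<partial>R))"
    by (intro Liminf_mono always_eventually allI TVk)
  also have "\<dots> = ennreal (\<integral>x. ?p x * indicat_real W x \<partial>R)"
    by (intro lim_imp_Liminf[OF trivial_limit_sequentially] tendsto_ennrealI limI)
  \<comment> \<open>Nonnegativity of the approximating integrals passes to the limit, so the bound
    in \<open>ennreal\<close> is also one between reals.\<close>
  finally show ?thesis
    using LIMSEQ_le_const[OF limI] pk_nn by (intro enn2real_leI) auto
qed

theorem one_step_is_arg_min:
  assumes A: "A \<in> borel_subsets \<Omega>"
  shows "is_arg_min
           (\<lambda>E. (\<integral>\<^sup>+ x. ennreal (\<bar>indicat_real E x - indicat_real A x\<bar> * (bdist \<Omega> A x / \<epsilon>))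
                   \<partial>slice_sum \<Omega> \<mu>) + Per \<Omega> \<mu> \<epsilon> E)
           (\<lambda>E. E \<in> borel_subsets \<Omega>)
           (one_step \<Omega> \<mu> \<epsilon> A)"
proof -
  define w where "w = w_star \<Omega> \<mu> \<epsilon> A"
  define W where "W = one_step \<Omega> \<mu> \<epsilon> A"
  let ?g = "sdist \<Omega> (\<Omega> - A)"
  have W_eq: "W = {x\<in>\<Omega>. w x > 0}" by (simp add: W_def w_def one_step_def)
  have w: "w \<in> L2 \<Omega>"
    and min: "\<And>u. u \<in> L2 \<Omega> \<Longrightarrow> step_energy \<Omega> \<mu> \<epsilon> A w \<le> step_energy \<Omega> \<mu> \<epsilon> A u"
    using w_star_minimizer[of A] by (auto simp: is_arg_min_def w_def not_less)
  have wm [measurable]: "w \<in> borel_measurable (leb \<Omega>)" by (rule L2_measurable[OF w])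
  have "W = {x\<in>space (leb \<Omega>). w x > 0}" by (simp add: W_eq space_restrict_space)
  also have "\<dots> \<in> sets (leb \<Omega>)" by measurable
  finally have W: "W \<in> borel_subsets \<Omega>" by (simp add: borel_subsets_eq)
  let ?F = "\<lambda>E. \<integral>\<^sup>+ x. ennreal (\<bar>indicat_real E x - indicat_real A x\<bar> * (bdist \<Omega> A x / \<epsilon>)) \<partial>R"
  let ?P = "\<lambda>E. enn2real (Per \<Omega> \<mu> \<epsilon> E)"
  let ?a = "\<integral>x. indicat_real A x * (?g x / \<epsilon>) \<partial>R"
  let ?f = "\<lambda>E. ?a - (\<integral>x. indicat_real E x * (?g x / \<epsilon>) \<partial>R)"
  let ?w = "\<lambda>E. \<integral>x. indicat_real E x * (w x / \<epsilon>) \<partial>R"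
  \<comment> \<open>All terms are finite and nonnegative, so the comparison can be carried out with
    real numbers.\<close>
  have total: "?F E + Per \<Omega> \<mu> \<epsilon> E = ennreal (?f E + ?P E)" if "E \<in> borel_subsets \<Omega>" for E
    using fidelity_eq[OF A that] Per_eq_real[OF that]
    by (metis (no_types, lifting) ennreal_plus enn2real_nonneg)
  have ig: "integrable R (\<lambda>x. indicat_real E x * (?g x / \<epsilon>))"
    and iw: "integrable R (\<lambda>x. indicat_real E x * (w x / \<epsilon>))" if "E \<in> borel_subsets \<Omega>" for E
    using L2_integrable_mult[OF indicator_L2[OF that] sdist_L2, of "\<Omega> - A"]
      L2_integrable_mult[OF indicator_L2[OF that] w] by simp_all
  have p: "(\<integral>x. (?g x - w x) / \<epsilon> * indicat_real E x \<partial>R) = ?a - ?f E - ?w E"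
    if E: "E \<in> borel_subsets \<Omega>" for E
  proof -
    have "(\<integral>x. (?g x - w x) / \<epsilon> * indicat_real E x \<partial>R)
        = (\<integral>x. indicat_real E x * (?g x / \<epsilon>) - indicat_real E x * (w x / \<epsilon>) \<partial>R)"
      by (intro Bochner_Integration.integral_cong) (auto simp: diff_divide_distrib algebra_simps)
    also have "\<dots> = (\<integral>x. indicat_real E x * (?g x / \<epsilon>) \<partial>R) - ?w E"
      by (rule Bochner_Integration.integral_diff[OF ig[OF E] iw[OF E]])
    finally show ?thesis by simp
  qed
  have "?F W + Per \<Omega> \<mu> \<epsilon> W \<le> ?F E + Per \<Omega> \<mu> \<epsilon> E" if E: "E \<in> borel_subsets \<Omega>" for E
  proof -
    \<comment> \<open>The value \<open>?f + ?P\<close> is at most \<open>?a - ?w W\<close> for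
      \<open>W\<close> and at least \<open>?a - ?w E\<close> for any \<open>E\<close>, so only
      \<open>?w E\<close> and \<open>?w W\<close> remain to be compared.\<close>
    have "?P W \<le> ?a - ?f W - ?w W"
      using minimizer_Per_le[OF w min] unfolding W_eq[symmetric] p[OF W] .
    moreover have "?a - ?f E - ?w E \<le> ?P E"
      using minimizer_Per_ge[OF w min E] unfolding p[OF E] .
    \<comment> \<open>Pointwise comparison: \<open>W\<close> keeps all positive values of
      \<open>w\<close> and drops all others.\<close>
    moreover have "?w E \<le> ?w W"
      using eps_pos iw[OF E] iw[OF W]
      by (intro integral_mono) (auto simp: W_eq indicator_def divide_nonpos_pos)
    ultimately show ?thesis
      unfolding total[OF E] total[OF W] by (intro ennreal_leI) linarith
  qed
  then show ?thesis
    using W by (auto simp: is_arg_min_def W_def[symmetric] not_less)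
qed

end

theorem proposition4p2:
  fixes \<Omega> :: "'a::euclidean_space set"
    and \<mu> :: "('a \<times> nat) measure"
    and \<rho> :: "nat \<Rightarrow> 'a \<Rightarrow> real"
    and \<epsilon> c :: real
    and A :: "'a set"
  assumes "open \<Omega>" and "connected \<Omega>" and "bounded \<Omega>" and "\<Omega> \<noteq> {}"
    and "\<epsilon> > 0"
    and "prob_space \<mu>"
    and "sets \<mu> = sets (restrict_space borel \<Omega> \<Otimes>\<^sub>M count_space {0, 1})"
    and "\<And>i x. i \<in> {0, 1} \<Longrightarrow> x \<in> \<Omega> \<Longrightarrow> \<rho> i x \<ge> 0"
    and "\<And>i. i \<in> {0, 1} \<Longrightarrow> slice \<Omega> \<mu> i = density (leb \<Omega>) (\<lambda>x. ennreal (\<rho> i x))"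
    and "\<And>i. i \<in> {0, 1} \<Longrightarrow> C1_on \<Omega> (\<rho> i)"
    and "c > 0"
    and "\<And>x. x \<in> \<Omega> \<Longrightarrow> c < \<rho> 0 x + \<rho> 1 x \<and> \<rho> 0 x + \<rho> 1 x < inverse c"
    and "A \<in> borel_subsets \<Omega>"
  shows "is_arg_min
           (\<lambda>E. (\<integral>\<^sup>+ x. ennreal (\<bar>indicat_real E x - indicat_real A x\<bar> * (bdist \<Omega> A x / \<epsilon>))
                   \<partial>slice_sum \<Omega> \<mu>) + Per \<Omega> \<mu> \<epsilon> E)
           (\<lambda>E. E \<in> borel_subsets \<Omega>)
           (one_step \<Omega> \<mu> \<epsilon> A)"
proof -
  interpret nonlocal_perimeter \<Omega> \<mu> \<rho> \<epsilon> c
  proof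
    fix i :: nat assume i: "i \<in> {0, 1}"
    obtain D :: "'a \<Rightarrow> 'a \<Rightarrow>\<^sub>L real"
      where "\<And>x. x \<in> \<Omega> \<Longrightarrow> (\<rho> i has_derivative blinfun_apply (D x)) (at x)"
      using assms(10)[OF i] by (auto simp: C1_on_def)
    \<comment> \<open>Differentiability gives continuity, and thereby the Borel measurability of the
      densities required by the locale.\<close>
    then have "continuous_on \<Omega> (\<rho> i)"
      by (intro continuous_at_imp_continuous_on) (blast dest: has_derivative_continuous)
    then have "\<rho> i \<in> borel_measurable (restrict_space borel \<Omega>)"
      by (rule borel_measurable_continuous_on_restrict)
    also have "borel_measurable (restrict_space borel \<Omega>) = borel_measurable (leb \<Omega>)"
      by (intro measurable_cong_sets sets_restrict_space_cong) auto
    finally show "\<rho> i \<in> borel_measurable (leb \<Omega>)" .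
  qed (use assms in auto)
  show ?thesis by (rule one_step_is_arg_min[OF assms(13)])
qed

end
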